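(* Let $a,b\geq 0$ and $n$ be integers with $b+1\leq n$. The multiplicity of the sign representation of $S_n$ in the restriction of $W_{(a+1,1^b)}(\mathbb C^n)$ to $S_n$ equals the number of pairs $(\lambda,\mu)$ of integer sequences such that (1) $\lambda=(\lambda_1,\dotsc,\lambda_b)$ with $\lambda_1\geq\cdots\geq\lambda_b\geq 0$, and $\mu=(\mu_1,\dotsc,\mu_{n-b})$ with $\mu_1>\cdots>\mu_{n-b}\geq 0$; (2) $\lambda_1+\cdots+\lambda_b+\mu_1+\cdots+\mu_{n-b}=a+1$, and $\mu_1>\lambda_1$ (this last inequality being vacuous when $b=0$).
   Context: For a partition $\nu$ with at most $n$ parts, $W_\nu(\mathbb C^n)$ denotes the irreducible polynomial representation (Weyl module) of $GL_n(\mathbb C)$ indexed by $\nu$. $S_n$ is regarded as the subgroup of permutation matrices of $GL_n(\mathbb C)$. $(a+1,1^b)$ is the hook partition with first part $a+1$ followed by $b$ parts equal to $1$. *)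

theory Defs
  imports Complex_Main "HOL-Library.Function_Algebras" "HOL-Combinatorics.Permutations"
begin

text \<open>Partitions are lists of positive naturals in weakly decreasing order.
  Boxes of the Young diagram are numbered 0..k-1 row by row (canonical tableau),
  where k = sum_list nu.\<close>

definition hook :: "nat \<Rightarrow> nat \<Rightarrow> nat list" where
  "hook a b = Suc a # replicate b 1"

definition row_of :: "nat list \<Rightarrow> nat \<Rightarrow> nat" where
  "row_of nu m = (LEAST i. m < sum_list (take (Suc i) nu))"

definition col_of :: "nat list \<Rightarrow> nat \<Rightarrow> nat" where
  "col_of nu m = m - sum_list (take (row_of nu m) nu)"

definition row_group :: "nat list \<Rightarrow> (nat \<Rightarrow> nat) set" where
  "row_group nu = {p. p permutes {..<sum_list nu} \<and>
      (\<forall>m<sum_list nu. row_of nu (p m) = row_of nu m)}"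

definition col_group :: "nat list \<Rightarrow> (nat \<Rightarrow> nat) set" where
  "col_group nu = {q. q permutes {..<sum_list nu} \<and>
      (\<forall>m<sum_list nu. col_of nu (q m) = col_of nu m)}"

text \<open>Tensors in (C^n)^{\<otimes>k}: coefficient functions on words w of length k with letters < n
  (the coefficient of e_{w_0} \<otimes> ... \<otimes> e_{w_{k-1}}).\<close>

definition tensors :: "nat \<Rightarrow> nat \<Rightarrow> (nat list \<Rightarrow> complex) set" where
  "tensors n k = {f. \<forall>w. f w \<noteq> 0 \<longrightarrow> length w = k \<and> set w \<subseteq> {..<n}}"

text \<open>S_k acting on tensor positions: sigma (e_w) = e_{w o sigma^{-1}}.\<close>
definition pos_act :: "(nat \<Rightarrow> nat) \<Rightarrow> (nat list \<Rightarrow> complex) \<Rightarrow> (nat list \<Rightarrow> complex)" where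
  "pos_act \<sigma> f = (\<lambda>w. f (map (\<lambda>i. w ! \<sigma> i) [0..<length w]))"

definition young_sym :: "nat list \<Rightarrow> (nat list \<Rightarrow> complex) \<Rightarrow> (nat list \<Rightarrow> complex)" where
  "young_sym nu f = (\<lambda>w. \<Sum>p\<in>row_group nu. \<Sum>q\<in>col_group nu.
      of_int (sign q) * pos_act (p \<circ> q) f w)"

definition weyl_module :: "nat \<Rightarrow> nat list \<Rightarrow> (nat list \<Rightarrow> complex) set" where
  "weyl_module n nu = young_sym nu ` tensors n (sum_list nu)"

text \<open>A permutation matrix pi in GL_n acting on tensors: pi (e_w) = e_{pi o w}.\<close>
definition perm_mat_act :: "(nat \<Rightarrow> nat) \<Rightarrow> (nat list \<Rightarrow> complex) \<Rightarrow> (nat list \<Rightarrow> complex)" where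
  "perm_mat_act \<pi> f = (\<lambda>w. f (map (inv \<pi>) w))"

abbreviation cscale :: "complex \<Rightarrow> (nat list \<Rightarrow> complex) \<Rightarrow> (nat list \<Rightarrow> complex)" where
  "cscale c f \<equiv> (\<lambda>w. c * f w)"

text \<open>Multiplicity of the sign representation of S_n in Res W_nu(C^n):
  the complex dimension of Hom_{S_n}(sgn, W), i.e. of the sign-isotypic vectors.\<close>
definition sign_multiplicity :: "nat \<Rightarrow> nat list \<Rightarrow> nat" where
  "sign_multiplicity n nu = vector_space.dim cscale
     {v \<in> weyl_module n nu. \<forall>\<pi>. \<pi> permutes {..<n} \<longrightarrow>
         perm_mat_act \<pi> v = cscale (of_int (sign \<pi>)) v}"

end

theory Submission
  imports Defs
begin

text \<open>
  Put \<open>k = a + 1 + b\<close>. Tensors that are symmetric in the first \<open>c\<close> positions and alternating in the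
  other \<open>k - c\<close> form \<open>Sym\<^sup>c \<otimes> \<Lambda>\<^bsup>k-c\<^esup>\<close>, and these spaces make up a Koszul complex whose differential
  moves one position from the alternating to the symmetric block. Moving a position back is a
  homotopy \<open>h\<close> with \<open>dh + hd = k\<close>, so the complex is exact; the same identity shows that the Young
  symmetrizer of the hook acts as a nonzero scalar on the cycles, hence the Weyl module is the space
  of cycles in \<open>Sym\<^bsup>a+1\<^esup> \<otimes> \<Lambda>\<^sup>b\<close>.

  The sign-equivariant part of \<open>Sym\<^sup>c \<otimes> \<Lambda>\<^sup>b\<close> has a basis indexed by the \<open>S\<^sub>n\<close>-orbits of pairs (exponent
  vector, \<open>b\<close>-subset of the letters) whose stabilizer acts by the sign. These are the pairs
  \<open>(\<lambda>, \<mu>)\<close> of size \<open>c\<close>, with \<open>\<lambda>\<close> the exponents on the subset and \<open>\<mu>\<close>, necessarily strict, those off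
  it. By exactness the dimensions \<open>K(b, c)\<close> of the sign-equivariant cycles satisfy
  \<open>K(b, c) + K(b - 1, c + 1) = #pairs(b, c)\<close>. The pairs with \<open>\<mu>\<^sub>1 > \<lambda>\<^sub>1\<close> obey the same recursion: if
  \<open>\<lambda>\<^sub>1 \<ge> \<mu>\<^sub>1\<close>, then transfer \<open>\<lambda>\<^sub>1 + 1\<close> to \<open>\<mu>\<close>.
\<close>

section \<open>Symmetrization over positions\<close>

text \<open>The flag \<open>e\<close> selects the sign character (\<open>True\<close>) or the trivial one (\<open>False\<close>).\<close>

definition chr :: "bool \<Rightarrow> (nat \<Rightarrow> nat) \<Rightarrow> complex" where
  "chr e \<sigma> = (if e then of_int (sign \<sigma>) else 1)"

definition skew :: "bool \<Rightarrow> nat set \<Rightarrow> (nat list \<Rightarrow> complex) \<Rightarrow> bool" where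
  "skew e B f \<longleftrightarrow> (\<forall>\<sigma>. \<sigma> permutes B \<longrightarrow> pos_act \<sigma> f = cscale (chr e \<sigma>) f)"

text \<open>
  The transpositions \<open>(m j)\<close> represent the cosets of \<open>Sym (B - {m})\<close> in \<open>Sym B\<close>, so \<open>ext_sum\<close>
  extends the equivariance of \<open>f\<close> from \<open>B - {m}\<close> to \<open>B\<close>. With the trivial character it is the
  Koszul differential, with the sign character the homotopy.
\<close>

definition ext_sum :: "bool \<Rightarrow> nat set \<Rightarrow> nat \<Rightarrow> (nat list \<Rightarrow> complex) \<Rightarrow> nat list \<Rightarrow> complex" where
  "ext_sum e B m f = (\<lambda>w. \<Sum>j\<in>B. chr e (transpose m j) * pos_act (transpose m j) f w)"

definition avg :: "bool \<Rightarrow> nat set \<Rightarrow> (nat list \<Rightarrow> complex) \<Rightarrow> nat list \<Rightarrow> complex" where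
  "avg e B f = (\<lambda>w. \<Sum>\<sigma> | \<sigma> permutes B. chr e \<sigma> * pos_act \<sigma> f w)"

section \<open>Characters and the action on positions\<close>

lemma chr_id [simp]: "chr e id = 1"
  by (simp add: chr_def)

lemma chr_False [simp]: "chr False \<sigma> = 1"
  by (simp add: chr_def)

lemma chr_transpose: "chr e (transpose i j) = (if e \<and> i \<noteq> j then -1 else 1)"
  by (simp add: chr_def sign_swap_id)

lemma chr_square [simp]: "chr e \<sigma> * chr e \<sigma> = 1" "chr e \<sigma> * (chr e \<sigma> * x) = x"
  by (cases \<sigma> rule: sign_cases; simp add: chr_def)+

lemma chr_comp:
  assumes "\<sigma> permutes B" "\<tau> permutes B" "finite B"
  shows "chr e (\<sigma> \<circ> \<tau>) = chr e \<sigma> * chr e \<tau>"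
  using assms by (simp add: chr_def sign_compose permutes_imp_permutation)

lemma pos_act_permute_list: "pos_act \<sigma> f w = f (permute_list \<sigma> w)"
  by (simp add: pos_act_def permute_list_def)

lemma pos_act_id [simp]: "pos_act id f = f"
  by (simp add: pos_act_permute_list fun_eq_iff)

lemma pos_act_sum: "pos_act \<sigma> (\<lambda>w. \<Sum>j\<in>B. c j * g j w) = (\<lambda>w. \<Sum>j\<in>B. c j * pos_act \<sigma> (g j) w)"
  by (simp add: pos_act_def)

lemma pos_act_cscale: "pos_act \<sigma> (cscale c f) = cscale c (pos_act \<sigma> f)"
  by (simp add: pos_act_def)

lemma tensors_zero: "f \<in> tensors n k \<Longrightarrow> length w \<noteq> k \<Longrightarrow> f w = 0"
  by (auto simp: tensors_def)

text \<open>Reindexing is a right action on words, hence a left action on coefficient functions.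
  Words of a length other than \<open>k\<close> are settled separately: reindexing keeps the length,
  so \<open>f\<close> vanishes on both sides.\<close>

lemma pos_act_comp:
  assumes "f \<in> tensors n k" "\<tau> permutes {..<k}"
  shows "pos_act \<sigma> (pos_act \<tau> f) = pos_act (\<sigma> \<circ> \<tau>) f"
proof
  fix w
  show "pos_act \<sigma> (pos_act \<tau> f) w = pos_act (\<sigma> \<circ> \<tau>) f w"
  proof (cases "length w = k")
    case True
    then show ?thesis using assms(2) by (simp add: pos_act_permute_list permute_list_compose)
  next
    case False
    then show ?thesis using assms(1) by (simp add: pos_act_permute_list tensors_zero)
  qed
qed

lemma tensors_pos_act:
  assumes "f \<in> tensors n k" "\<tau> permutes {..<k}"
  shows "pos_act \<tau> f \<in> tensors n k"
  unfolding tensors_def mem_Collect_eq pos_act_permute_list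
proof (intro allI impI)
  fix w assume "f (permute_list \<tau> w) \<noteq> 0"
  then have "length w = k" "set (permute_list \<tau> w) \<subseteq> {..<n}"
    using assms(1) by (auto simp: tensors_def)
  then show "length w = k \<and> set w \<subseteq> {..<n}" using assms(2) by simp
qed

lemma tensors_sum:
  assumes "\<And>j. j \<in> B \<Longrightarrow> g j \<in> tensors n k"
  shows "(\<lambda>w. \<Sum>j\<in>B. c j * g j w) \<in> tensors n k"
  unfolding tensors_def mem_Collect_eq
proof (intro allI impI)
  fix w assume "(\<Sum>j\<in>B. c j * g j w) \<noteq> 0"
  then obtain j where "j \<in> B" "c j * g j w \<noteq> 0" by (meson sum.not_neutral_contains_not_neutral)
  then show "length w = k \<and> set w \<subseteq> {..<n}" using assms[of j] by (auto simp: tensors_def)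
qed

lemma tensors_cscale: "f \<in> tensors n k \<Longrightarrow> cscale c f \<in> tensors n k"
  by (auto simp: tensors_def)

lemma transpose_permutes: "i \<in> B \<Longrightarrow> j \<in> B \<Longrightarrow> B \<subseteq> {..<k::nat} \<Longrightarrow> transpose i j permutes {..<k}"
  by (intro permutes_swap_id) auto

lemma tensors_ext_sum:
  assumes "f \<in> tensors n k" "m \<in> B" "B \<subseteq> {..<k}"
  shows "ext_sum e B m f \<in> tensors n k"
  unfolding ext_sum_def
  by (intro tensors_sum tensors_pos_act assms(1) transpose_permutes[OF assms(2) _ assms(3)])

lemma tensors_avg:
  assumes "f \<in> tensors n k" "B \<subseteq> {..<k}"
  shows "avg e B f \<in> tensors n k"
  unfolding avg_def using assms
  by (intro tensors_sum tensors_pos_act) (auto intro: permutes_subset)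

lemma skew_mono: "skew e B f \<Longrightarrow> A \<subseteq> B \<Longrightarrow> skew e A f"
  by (auto simp: skew_def dest: permutes_subset)

lemma skew_cscale: "skew e B f \<Longrightarrow> skew e B (cscale c f)"
  by (auto simp: skew_def pos_act_cscale)

section \<open>Equivariance of coset sums and of group averages\<close>

lemma permutes_disjoint_comp:
  assumes "\<sigma> permutes B" "\<tau> permutes C" "B \<inter> C = {}"
  shows "\<sigma> \<circ> \<tau> = \<tau> \<circ> \<sigma>"
proof
  fix x
  consider "x \<in> B" "x \<notin> C" | "x \<in> C" "x \<notin> B" | "x \<notin> B" "x \<notin> C" using assms(3) by blast
  then show "(\<sigma> \<circ> \<tau>) x = (\<tau> \<circ> \<sigma>) x"
  proof cases
    case 1
    then have "\<sigma> x \<notin> C" using assms(1,3) by (meson disjoint_iff permutes_in_image)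
    with 1 show ?thesis using assms(2) by (simp add: permutes_not_in)
  next
    case 2
    then have "\<tau> x \<notin> B" using assms(2,3) by (meson disjoint_iff permutes_in_image)
    with 2 show ?thesis using assms(1) by (simp add: permutes_not_in)
  next
    case 3
    then show ?thesis using assms(1,2) by (simp add: permutes_not_in)
  qed
qed

text \<open>Permutations of the disjoint sets \<open>B\<close> and \<open>C\<close> commute, so
  \<open>\<sigma>\<close> passes through every \<open>\<tau> j\<close> and reaches
  \<open>f\<close>.\<close>

lemma skew_pos_act_sum:
  assumes f: "f \<in> tensors n k" "skew e C f" and "C \<subseteq> {..<k}"
    and \<tau>: "\<And>j. j \<in> J \<Longrightarrow> \<tau> j permutes B" and B: "B \<subseteq> {..<k}" "B \<inter> C = {}"
  shows "skew e C (\<lambda>w. \<Sum>j\<in>J. c j * pos_act (\<tau> j) f w)"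
  unfolding skew_def
proof (intro allI impI ext)
  fix \<sigma> w assume \<sigma>: "\<sigma> permutes C"
  then have \<sigma>k: "\<sigma> permutes {..<k}" using assms(3) permutes_subset by blast
  have "pos_act \<sigma> (pos_act (\<tau> j) f) w = chr e \<sigma> * pos_act (\<tau> j) f w" if "j \<in> J" for j
  proof -
    have \<tau>k: "\<tau> j permutes {..<k}" using \<tau>[OF that] B(1) permutes_subset by blast
    have "pos_act \<sigma> (pos_act (\<tau> j) f) w = pos_act (\<tau> j) (pos_act \<sigma> f) w"
      using permutes_disjoint_comp[OF \<tau>[OF that] \<sigma> B(2)]
      by (simp add: pos_act_comp[OF f(1) \<tau>k] pos_act_comp[OF f(1) \<sigma>k])
    also have "pos_act \<sigma> f = cscale (chr e \<sigma>) f" using f(2) \<sigma> by (simp add: skew_def)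
    finally show ?thesis by (simp add: pos_act_cscale)
  qed
  then show "pos_act \<sigma> (\<lambda>w. \<Sum>j\<in>J. c j * pos_act (\<tau> j) f w) w
      = chr e \<sigma> * (\<Sum>j\<in>J. c j * pos_act (\<tau> j) f w)"
    unfolding pos_act_sum by (simp add: sum_distrib_left mult.left_commute)
qed

lemma skew_ext_sum_disjoint:
  assumes "f \<in> tensors n k" "skew e C f" "C \<subseteq> {..<k}" "m \<in> B" "B \<subseteq> {..<k}" "B \<inter> C = {}"
  shows "skew e C (ext_sum e' B m f)"
  unfolding ext_sum_def
  by (rule skew_pos_act_sum[OF assms(1-3) _ assms(5,6)]) (use assms(4) in \<open>auto intro: permutes_swap_id\<close>)

lemma skew_avg_disjoint:
  assumes "f \<in> tensors n k" "skew e C f" "C \<subseteq> {..<k}" "B \<subseteq> {..<k}" "B \<inter> C = {}"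
  shows "skew e C (avg e' B f)"
  unfolding avg_def
  by (rule skew_pos_act_sum[OF assms(1-3) _ assms(4,5)]) auto

text \<open>Following \<open>\<sigma>\<close> by the transposition of \<open>m\<close> and
  \<open>\<sigma> m\<close> gives a permutation that fixes \<open>m\<close>, on which
  \<open>f\<close> has its character. Up to that scalar, \<open>\<sigma>\<close> acts like the
  representative of its coset.\<close>

lemma pos_act_pivot:
  assumes f: "f \<in> tensors n k" "skew e (B - {m}) f" and B: "m \<in> B" "B \<subseteq> {..<k}" and \<sigma>: "\<sigma> permutes B"
  shows "pos_act \<sigma> f w = chr e \<sigma> * chr e (transpose m (\<sigma> m)) * pos_act (transpose m (\<sigma> m)) f w"
proof -
  define \<tau> where "\<tau> = transpose m (\<sigma> m) \<circ> \<sigma>"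
  have \<tau>: "\<tau> permutes B - {m}"
    unfolding \<tau>_def using \<sigma> B(1) by (intro permutes_insert_lemma) (simp add: insert_absorb)
  have tr: "transpose m (\<sigma> m) permutes B" using B(1) \<sigma> by (simp add: permutes_swap_id permutes_in_image)
  have \<tau>B: "\<tau> permutes B" using \<tau> permutes_subset by blast
  have \<tau>k: "\<tau> permutes {..<k}" using \<tau>B B(2) permutes_subset by blast
  have fin: "finite B" using B(2) finite_subset by blast
  have \<sigma>_eq: "\<sigma> = transpose m (\<sigma> m) \<circ> \<tau>" by (simp add: \<tau>_def o_assoc)
  have "chr e \<tau> = chr e \<sigma> * chr e (transpose m (\<sigma> m))"
    unfolding \<tau>_def by (subst chr_comp[OF tr \<sigma> fin]) simp
  moreover have "pos_act \<sigma> f = pos_act (transpose m (\<sigma> m)) (pos_act \<tau> f)"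
    by (subst pos_act_comp[OF f(1) \<tau>k]) (simp add: \<sigma>_eq[symmetric])
  moreover have "pos_act \<tau> f = cscale (chr e \<tau>) f" using f(2) \<tau> by (simp add: skew_def)
  ultimately show ?thesis by (simp add: pos_act_cscale)
qed

text \<open>Left multiplication by \<open>\<sigma>\<close> permutes the cosets: that of
  \<open>transpose m j\<close> goes to that of \<open>transpose m (\<sigma> j)\<close>, since a
  coset is determined by the image of \<open>m\<close>.\<close>

lemma skew_ext_sum:
  assumes f: "f \<in> tensors n k" "skew e (B - {m}) f" and B: "m \<in> B" "B \<subseteq> {..<k}"
  shows "skew e B (ext_sum e B m f)"
  unfolding skew_def
proof (intro allI impI ext)
  fix \<sigma> w assume \<sigma>: "\<sigma> permutes B"
  have fin: "finite B" using B(2) finite_subset by blast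
  have "chr e (transpose m j) * pos_act \<sigma> (pos_act (transpose m j) f) w =
      chr e \<sigma> * (chr e (transpose m (\<sigma> j)) * pos_act (transpose m (\<sigma> j)) f w)" if j: "j \<in> B" for j
  proof -
    have tr: "transpose m j permutes B" using B(1) j by (simp add: permutes_swap_id)
    then have trk: "transpose m j permutes {..<k}" using B(2) permutes_subset by blast
    have "pos_act \<sigma> (pos_act (transpose m j) f) w = pos_act (\<sigma> \<circ> transpose m j) f w"
      by (simp add: pos_act_comp[OF f(1) trk])
    also have "\<dots> = chr e (\<sigma> \<circ> transpose m j) * chr e (transpose m (\<sigma> j)) * pos_act (transpose m (\<sigma> j)) f w"
      using pos_act_pivot[OF f B permutes_compose[OF tr \<sigma>], of w] by simp
    also have "chr e (\<sigma> \<circ> transpose m j) = chr e \<sigma> * chr e (transpose m j)"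
      by (rule chr_comp[OF \<sigma> tr fin])
    finally show ?thesis by (simp add: mult_ac)
  qed
  then have "pos_act \<sigma> (ext_sum e B m f) w =
      chr e \<sigma> * (\<Sum>j\<in>B. chr e (transpose m (\<sigma> j)) * pos_act (transpose m (\<sigma> j)) f w)"
    by (simp add: ext_sum_def pos_act_sum sum_distrib_left)
  also have "(\<Sum>j\<in>B. chr e (transpose m (\<sigma> j)) * pos_act (transpose m (\<sigma> j)) f w) = ext_sum e B m f w"
    unfolding ext_sum_def
    by (rule sum.reindex_bij_betw[OF permutes_imp_bij[OF \<sigma>]])
  finally show "pos_act \<sigma> (ext_sum e B m f) w = chr e \<sigma> * ext_sum e B m f w" .
qed

text \<open>Each coset contributes \<open>(card B - 1)!\<close> equal terms. This links the full
  averages in the Young symmetrizer to the Koszul maps.\<close>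

lemma avg_eq_ext_sum:
  assumes f: "f \<in> tensors n k" "skew e (B - {m}) f" and B: "m \<in> B" "B \<subseteq> {..<k}"
  shows "avg e B f = cscale (fact (card B - 1)) (ext_sum e B m f)"
proof
  fix w
  define C where "C = B - {m}"
  have fin: "finite B" "finite C" using B(2) finite_subset by (auto simp: C_def)
  have BC: "B = insert m C" "m \<notin> C" using B(1) by (auto simp: C_def)
  have cardC: "card C = card B - 1" using fin(2) BC by simp
  have "chr e (transpose m j \<circ> q) * pos_act (transpose m j \<circ> q) f w
      = chr e (transpose m j) * pos_act (transpose m j) f w" if j: "j \<in> B" and q: "q permutes C" for j q
  proof -
    have tr: "transpose m j permutes B" using B(1) j by (simp add: permutes_swap_id)
    have qB: "q permutes B" using q permutes_subset by (auto simp: C_def)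
    then have qk: "q permutes {..<k}" using B(2) permutes_subset by blast
    have "pos_act q f = cscale (chr e q) f" using f(2) q by (simp add: skew_def C_def)
    then have "pos_act (transpose m j \<circ> q) f w = chr e q * pos_act (transpose m j) f w"
      by (simp add: pos_act_comp[OF f(1) qk, symmetric] pos_act_cscale)
    then show ?thesis by (simp add: chr_comp[OF tr qB fin(1)] mult_ac)
  qed
  then have "avg e B f w = (\<Sum>j\<in>B. \<Sum>q | q permutes C. chr e (transpose m j) * pos_act (transpose m j) f w)"
    unfolding avg_def BC(1) by (subst sum_over_permutations_insert[OF fin(2) BC(2)]) (simp add: BC(1))
  also have "\<dots> = fact (card B - 1) * ext_sum e B m f w"
    using card_permutations[OF cardC fin(2)] by (simp add: ext_sum_def sum_distrib_left)
  finally show "avg e B f w = fact (card B - 1) * ext_sum e B m f w" .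
qed

lemma skew_avg:
  assumes f: "f \<in> tensors n k" and B: "B \<subseteq> {..<k}"
  shows "skew e B (avg e B f)"
  unfolding skew_def
proof (intro allI impI ext)
  fix \<sigma> w assume \<sigma>: "\<sigma> permutes B"
  have fin: "finite B" using B finite_subset by blast
  have "chr e \<tau> * pos_act \<sigma> (pos_act \<tau> f) w = chr e \<sigma> * (chr e (\<sigma> \<circ> \<tau>) * pos_act (\<sigma> \<circ> \<tau>) f w)"
    if "\<tau> permutes B" for \<tau>
    using pos_act_comp[OF f permutes_subset[OF that B], of \<sigma>]
    by (simp add: chr_comp[OF \<sigma> that fin] mult_ac)
  then have "pos_act \<sigma> (avg e B f) w = chr e \<sigma> * (\<Sum>\<tau> | \<tau> permutes B. chr e (\<sigma> \<circ> \<tau>) * pos_act (\<sigma> \<circ> \<tau>) f w)"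
    by (simp add: avg_def pos_act_sum sum_distrib_left)
  also have "(\<Sum>\<tau> | \<tau> permutes B. chr e (\<sigma> \<circ> \<tau>) * pos_act (\<sigma> \<circ> \<tau>) f w) = avg e B f w"
    unfolding avg_def by (rule setum_permutations_compose_left[OF \<sigma>, symmetric])
  finally show "pos_act \<sigma> (avg e B f) w = chr e \<sigma> * avg e B f w" .
qed

lemma avg_pos_act:
  assumes f: "f \<in> tensors n k" and B: "B \<subseteq> {..<k}" and \<sigma>: "\<sigma> permutes B"
  shows "avg e B (pos_act \<sigma> f) = cscale (chr e \<sigma>) (avg e B f)"
proof
  fix w
  have fin: "finite B" using B finite_subset by blast
  have \<sigma>k: "\<sigma> permutes {..<k}" using \<sigma> B permutes_subset by blast
  have "avg e B (pos_act \<sigma> f) w = chr e \<sigma> * (\<Sum>\<tau> | \<tau> permutes B. chr e (\<tau> \<circ> \<sigma>) * pos_act (\<tau> \<circ> \<sigma>) f w)"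
    by (simp add: avg_def sum_distrib_left pos_act_comp[OF f \<sigma>k] chr_comp[OF _ \<sigma> fin] mult_ac)
  also have "(\<Sum>\<tau> | \<tau> permutes B. chr e (\<tau> \<circ> \<sigma>) * pos_act (\<tau> \<circ> \<sigma>) f w) = avg e B f w"
    unfolding avg_def by (rule sum_permutations_compose_right[OF \<sigma>, symmetric])
  finally show "avg e B (pos_act \<sigma> f) w = chr e \<sigma> * avg e B f w" .
qed

lemma avg_cscale: "avg e B (cscale c f) = cscale c (avg e B f)"
  by (simp add: avg_def pos_act_cscale sum_distrib_left mult.left_commute)

lemma avg_sum: "avg e B (\<lambda>w. \<Sum>j\<in>J. c j * g j w) = (\<lambda>w. \<Sum>j\<in>J. c j * avg e B (g j) w)"
proof
  fix w
  show "avg e B (\<lambda>w. \<Sum>j\<in>J. c j * g j w) w = (\<Sum>j\<in>J. c j * avg e B (g j) w)"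
    unfolding avg_def pos_act_sum sum_distrib_left
    by (subst sum.swap) (simp add: mult.left_commute)
qed

text \<open>The transposition of \<open>x\<close> and \<open>y\<close> negates \<open>f\<close>,
  whereas the symmetric average absorbs it without a sign; so the average equals its own
  negative.\<close>

lemma avg_False_alternating:
  assumes f: "f \<in> tensors n k" "skew True A f" and xy: "x \<in> A" "y \<in> A" "x \<noteq> y"
    and B: "x \<in> B" "y \<in> B" "B \<subseteq> {..<k}"
  shows "avg False B f w = 0"
proof -
  have "pos_act (transpose x y) f = cscale (chr True (transpose x y)) f"
    using f(2) permutes_swap_id[OF xy(1,2)] by (simp add: skew_def)
  then have "avg False B f w = - avg False B f w"
    using fun_cong[OF avg_pos_act[OF f(1) B(3) permutes_swap_id[OF B(1,2)], of False], of w] xy(3)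
    by (simp add: avg_cscale chr_transpose avg_cscale[of _ _ "-1", simplified])
  then show ?thesis by simp
qed

lemma ext_sum_zero: "ext_sum e B m (\<lambda>w. 0) = (\<lambda>w. 0)"
  by (simp add: ext_sum_def pos_act_def)

lemma ext_sum_cscale: "ext_sum e B m (cscale c f) = cscale c (ext_sum e B m f)"
  by (simp add: ext_sum_def pos_act_cscale sum_distrib_left mult.left_commute)

text \<open>Both halves \<open>dh\<close> and \<open>hd\<close> of the homotopy identity are instances of this formula.\<close>

lemma ext_sum_ext_sum:
  assumes f: "f \<in> tensors n k" "skew e A f" and m: "m \<in> A" and disj: "A \<inter> C = {}"
    and sub: "A \<subseteq> {..<k}" "C \<subseteq> {..<k}"
  shows "ext_sum e A m (ext_sum e' (insert m C) m f) w =
    of_nat (card A) * f w + (if e' then -1 else 1) * (\<Sum>i\<in>A. \<Sum>j\<in>C. pos_act (transpose i j) f w)"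
proof -
  define s :: complex where "s = (if e' then -1 else 1)"
  have fin: "finite A" "finite C" using sub finite_subset by auto
  have mC: "m \<notin> C" using m disj by auto
  have "chr e' (transpose m j) = s" if "j \<in> C" for j
    using that mC by (auto simp: chr_transpose s_def)
  \<comment> \<open>The summand \<open>j = m\<close> is \<open>f\<close> itself; each other one
    carries the sign \<open>s\<close>.\<close>
  then have inner: "ext_sum e' (insert m C) m f = (\<lambda>w. f w + s * (\<Sum>j\<in>C. pos_act (transpose m j) f w))"
    using fin mC by (simp add: ext_sum_def sum_distrib_left)
  have *: "pos_act (transpose m i) (ext_sum e' (insert m C) m f) w =
      chr e (transpose m i) * (f w + s * (\<Sum>j\<in>C. pos_act (transpose i j) f w))" if i: "i \<in> A" for i
  proof -
    have tr: "transpose m i permutes A" using i m by (simp add: permutes_swap_id)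
    have trk: "transpose m i permutes {..<k}" using i m sub(1) by (auto intro: permutes_swap_id)
    have fi: "pos_act (transpose m i) f = cscale (chr e (transpose m i)) f"
      using f(2) tr by (simp add: skew_def)
    have "pos_act (transpose m i) (pos_act (transpose m j) f) w =
        chr e (transpose m i) * pos_act (transpose i j) f w" if j: "j \<in> C" for j
    proof -
      have jk: "transpose m j permutes {..<k}" using j m sub by (auto intro: permutes_swap_id)
      have "j \<noteq> i" "j \<noteq> m" using i j disj mC by auto
      \<comment> \<open>Conjugation by \<open>transpose m i\<close> replaces the pivot
        \<open>m\<close> by \<open>i\<close>; \<open>f\<close> then absorbs that transposition
        through its character, which cancels against the coefficient in the outer sum.\<close>
      then have "transpose m i \<circ> transpose m j = transpose i j \<circ> transpose m i"
        by (auto simp: fun_eq_iff transpose_def)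
      then have "pos_act (transpose m i) (pos_act (transpose m j) f) = pos_act (transpose i j) (pos_act (transpose m i) f)"
        by (simp add: pos_act_comp[OF f(1) jk] pos_act_comp[OF f(1) trk])
      then show ?thesis by (simp add: fi pos_act_cscale)
    qed
    moreover have "pos_act (transpose m i) (ext_sum e' (insert m C) m f) w =
        pos_act (transpose m i) f w + s * (\<Sum>j\<in>C. pos_act (transpose m i) (pos_act (transpose m j) f) w)"
      unfolding inner by (simp add: pos_act_def)
    ultimately show ?thesis by (simp add: fi sum_distrib_left algebra_simps)
  qed
  have "ext_sum e A m (ext_sum e' (insert m C) m f) w = (\<Sum>i\<in>A. f w + s * (\<Sum>j\<in>C. pos_act (transpose i j) f w))"
    unfolding ext_sum_def[of e A m] by (rule sum.cong) (simp_all add: *)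
  also have "\<dots> = of_nat (card A) * f w + s * (\<Sum>i\<in>A. \<Sum>j\<in>C. pos_act (transpose i j) f w)"
    by (simp add: sum.distrib sum_distrib_left)
  finally show ?thesis by (simp add: s_def)
qed

section \<open>The Koszul complex\<close>

definition sgn_equivariant :: "nat \<Rightarrow> (nat list \<Rightarrow> complex) \<Rightarrow> bool" where
  "sgn_equivariant n f \<longleftrightarrow>
    (\<forall>\<pi>. \<pi> permutes {..<n} \<longrightarrow> perm_mat_act \<pi> f = cscale (of_int (sign \<pi>)) f)"

definition sym_alt :: "nat \<Rightarrow> nat \<Rightarrow> nat \<Rightarrow> (nat list \<Rightarrow> complex) set" where
  "sym_alt n k c = {f \<in> tensors n k. skew False {..<c} f \<and> skew True {c..<k} f}"

abbreviation koszul_d :: "nat \<Rightarrow> (nat list \<Rightarrow> complex) \<Rightarrow> nat list \<Rightarrow> complex" where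
  "koszul_d c \<equiv> ext_sum False {..<Suc c} c"

text \<open>For \<open>c = k\<close> no alternating position is left to move and the outgoing
  differential is zero, so every element of \<open>sym_alt n k k\<close> counts as a cycle.\<close>

definition cycles :: "nat \<Rightarrow> nat \<Rightarrow> nat \<Rightarrow> (nat list \<Rightarrow> complex) set" where
  "cycles n k c = {f \<in> sym_alt n k c. c < k \<longrightarrow> koszul_d c f = (\<lambda>w. 0)}"

lemma perm_mat_act_pos_act:
  assumes "f \<in> tensors n k" "\<tau> permutes {..<k}"
  shows "perm_mat_act \<pi> (pos_act \<tau> f) = pos_act \<tau> (perm_mat_act \<pi> f)"
proof
  fix w
  show "perm_mat_act \<pi> (pos_act \<tau> f) w = pos_act \<tau> (perm_mat_act \<pi> f) w"
  proof (cases "length w = k")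
    case True
    then show ?thesis using assms(2) by (simp add: perm_mat_act_def pos_act_permute_list permute_list_map)
  next
    case False
    then show ?thesis using assms(1) by (simp add: perm_mat_act_def pos_act_permute_list tensors_zero)
  qed
qed

lemma perm_mat_act_sum:
  "perm_mat_act \<pi> (\<lambda>w. \<Sum>j\<in>J. c j * g j w) = (\<lambda>w. \<Sum>j\<in>J. c j * perm_mat_act \<pi> (g j) w)"
  by (simp add: perm_mat_act_def)

lemma sgn_equivariant_pos_act_sum:
  assumes "f \<in> tensors n k" "sgn_equivariant n f" "\<And>j. j \<in> J \<Longrightarrow> \<tau> j permutes {..<k}"
  shows "sgn_equivariant n (\<lambda>w. \<Sum>j\<in>J. c j * pos_act (\<tau> j) f w)"
  using assms
  by (simp add: sgn_equivariant_def perm_mat_act_sum perm_mat_act_pos_act pos_act_cscale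
      sum_distrib_left mult.left_commute)

lemma sgn_equivariant_ext_sum:
  assumes "f \<in> tensors n k" "sgn_equivariant n f" "m \<in> B" "B \<subseteq> {..<k}"
  shows "sgn_equivariant n (ext_sum e B m f)"
  unfolding ext_sum_def
  by (intro sgn_equivariant_pos_act_sum[OF assms(1,2)] transpose_permutes[OF assms(3) _ assms(4)])

lemma sgn_equivariant_cscale: "sgn_equivariant n f \<Longrightarrow> sgn_equivariant n (cscale c f)"
  by (simp add: sgn_equivariant_def perm_mat_act_def fun_eq_iff)

lemma koszul_d_sym_alt:
  assumes "f \<in> sym_alt n k c" "c < k"
  shows "koszul_d c f \<in> sym_alt n k (Suc c)"
proof -
  have f: "f \<in> tensors n k" "skew False {..<c} f" "skew True {c..<k} f"
    using assms(1) by (auto simp: sym_alt_def)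
  have eq: "{..<Suc c} - {c} = {..<c}" by auto
  have "skew False {..<Suc c} (koszul_d c f)"
    by (rule skew_ext_sum[OF f(1)]) (use f(2) assms(2) in \<open>simp_all only: eq, auto\<close>)
  moreover have "skew True {Suc c..<k} (koszul_d c f)"
    using f assms(2) by (intro skew_ext_sum_disjoint[of _ n k] skew_mono[OF f(3)]) auto
  ultimately show ?thesis
    using f assms(2) by (auto simp: sym_alt_def intro!: tensors_ext_sum)
qed

lemma koszul_h_sym_alt:
  assumes "f \<in> sym_alt n k (Suc c)" "c < k"
  shows "ext_sum True {c..<k} c f \<in> sym_alt n k c"
proof -
  have f: "f \<in> tensors n k" "skew False {..<Suc c} f" "skew True {Suc c..<k} f"
    using assms(1) by (auto simp: sym_alt_def)
  have eq: "{c..<k} - {c} = {Suc c..<k}" by auto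
  have "skew True {c..<k} (ext_sum True {c..<k} c f)"
    by (rule skew_ext_sum[OF f(1)]) (use f(3) assms(2) in \<open>simp_all only: eq, auto\<close>)
  moreover have "skew False {..<c} (ext_sum True {c..<k} c f)"
    using f assms(2) by (intro skew_ext_sum_disjoint[of _ n k] skew_mono[OF f(2)]) auto
  ultimately show ?thesis
    using f assms(2) by (auto simp: sym_alt_def intro!: tensors_ext_sum)
qed

text \<open>The full average is \<open>c!\<close> times the differential, so vanishing can be tested
  on the average, which absorbs permutations of its positions.\<close>

lemma koszul_d_zeroI:
  assumes f: "f \<in> tensors n k" "skew False {..<c} f" and c: "c < k"
    and z: "\<And>w. avg False {..<Suc c} f w = 0"
  shows "koszul_d c f = (\<lambda>w. 0)"
proof -
  have "{..<Suc c} - {c} = {..<c}" by auto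
  then have "avg False {..<Suc c} f = cscale (fact c) (koszul_d c f)"
    using avg_eq_ext_sum[of f n k False "{..<Suc c}" c] f c by auto
  then show ?thesis using z by (simp add: fun_eq_iff)
qed

lemma koszul_d_koszul_d:
  assumes "f \<in> sym_alt n k c" "Suc c < k"
  shows "koszul_d (Suc c) (koszul_d c f) = (\<lambda>w. 0)"
proof (rule koszul_d_zeroI)
  have f: "f \<in> tensors n k" "skew True {c..<k} f" using assms(1) by (auto simp: sym_alt_def)
  show "koszul_d c f \<in> tensors n k" "skew False {..<Suc c} (koszul_d c f)"
    using koszul_d_sym_alt[OF assms(1)] assms(2) by (auto simp: sym_alt_def)
  fix w
  \<comment> \<open>The outer average absorbs the transpositions of the inner differential; what
    remains symmetrizes the positions \<open>c\<close> and \<open>c + 1\<close>, in which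
    \<open>f\<close> alternates.\<close>
  have *: "avg False {..<Suc (Suc c)} (pos_act (transpose c j) f) w = 0" if "j < Suc c" for j
  proof -
    have "avg False {..<Suc (Suc c)} (pos_act (transpose c j) f) w = avg False {..<Suc (Suc c)} f w"
      using fun_cong[OF avg_pos_act[OF f(1) _ permutes_swap_id, of "{..<Suc (Suc c)}" c j False], of w] that assms(2)
      by auto
    also have "\<dots> = 0"
      by (rule avg_False_alternating[OF f, of c "Suc c"]) (use assms(2) in auto)
    finally show ?thesis .
  qed
  show "avg False {..<Suc (Suc c)} (koszul_d c f) w = 0"
    unfolding ext_sum_def avg_sum using * by (simp del: lessThan_Suc)
qed (use assms in auto)

text \<open>This is \<open>hd f = 0\<close> expanded with \<open>ext_sum_ext_sum\<close>. For
  \<open>c = k\<close> both sides are zero.\<close>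

lemma cycles_transpose_sum:
  assumes "f \<in> cycles n k c" "c \<le> k"
  shows "(\<Sum>i\<in>{..<c}. \<Sum>j\<in>{c..<k}. pos_act (transpose i j) f w) = - of_nat (k - c) * f w"
proof (cases "c < k")
  case True
  have f: "f \<in> tensors n k" "skew True {c..<k} f" "koszul_d c f = (\<lambda>w. 0)"
    using assms(1) True by (auto simp: cycles_def sym_alt_def)
  have "ext_sum True {c..<k} c (koszul_d c f) w =
      of_nat (k - c) * f w + (\<Sum>i\<in>{c..<k}. \<Sum>j\<in>{..<c}. pos_act (transpose i j) f w)"
  proof -
    have "{c..<k} \<inter> {..<c} = {}" "{c..<k} \<subseteq> {..<k}" "{..<c} \<subseteq> {..<k}" using True by auto
    then show ?thesis
      using ext_sum_ext_sum[OF f(1,2), of c "{..<c}" False w] True by (simp add: lessThan_Suc)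
  qed
  also have "(\<Sum>i\<in>{c..<k}. \<Sum>j\<in>{..<c}. pos_act (transpose i j) f w)
      = (\<Sum>i\<in>{..<c}. \<Sum>j\<in>{c..<k}. pos_act (transpose i j) f w)"
    by (subst sum.swap) (simp add: transpose_commute)
  finally show ?thesis
    by (simp add: f(3) ext_sum_zero add_eq_0_iff2)
qed (use assms(2) in auto)

text \<open>Expanding \<open>dh f\<close> gives \<open>c f\<close> minus the sum of the mixed
  transpositions, which is \<open>-(k - c) f\<close> on a cycle. The pivot \<open>m\<close> may be
  any symmetric position: the last one serves for exactness, position 0, the corner of the hook, for
  the Young symmetrizer.\<close>

lemma cycles_homotopy:
  assumes "f \<in> cycles n k c" "m < c" "c \<le> k"
  shows "ext_sum False {..<c} m (ext_sum True (insert m {c..<k}) m f) = cscale (of_nat k) f"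
proof
  fix w
  have f: "f \<in> tensors n k" "skew False {..<c} f"
    using assms(1) by (auto simp: cycles_def sym_alt_def)
  have "ext_sum False {..<c} m (ext_sum True (insert m {c..<k}) m f) w =
      of_nat c * f w + of_nat (k - c) * f w"
  proof -
    have "{..<c} \<inter> {c..<k} = {}" "{..<c} \<subseteq> {..<k}" "{c..<k} \<subseteq> {..<k}" using assms(3) by auto
    then show ?thesis
      using ext_sum_ext_sum[OF f, of m "{c..<k}" True w] assms(2) cycles_transpose_sum[OF assms(1,3), of w]
      by (simp add: algebra_simps)
  qed
  then show "ext_sum False {..<c} m (ext_sum True (insert m {c..<k}) m f) w = of_nat k * f w"
    using assms(3) by (simp add: of_nat_diff algebra_simps)
qed

lemma koszul_d_image:
  assumes "c < k"
  shows "koszul_d c ` {f \<in> sym_alt n k c. sgn_equivariant n f} =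
    {f \<in> cycles n k (Suc c). sgn_equivariant n f}"
proof (intro equalityI subsetI)
  fix g assume "g \<in> koszul_d c ` {f \<in> sym_alt n k c. sgn_equivariant n f}"
  then obtain f where f: "f \<in> sym_alt n k c" "sgn_equivariant n f" "g = koszul_d c f" by auto
  then have "sgn_equivariant n g"
    using assms by (auto simp: sym_alt_def intro!: sgn_equivariant_ext_sum)
  then show "g \<in> {f \<in> cycles n k (Suc c). sgn_equivariant n f}"
    using f koszul_d_sym_alt[OF f(1) assms] koszul_d_koszul_d[OF f(1)] by (simp add: cycles_def)
next
  fix g assume "g \<in> {f \<in> cycles n k (Suc c). sgn_equivariant n f}"
  then have g: "g \<in> cycles n k (Suc c)" "g \<in> sym_alt n k (Suc c)" "g \<in> tensors n k" "sgn_equivariant n g"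
    by (auto simp: cycles_def sym_alt_def)
  \<comment> \<open>Since \<open>dh\<close> multiplies cycles by \<open>k\<close>, the homotopy
    applied to \<open>g / k\<close> is a preimage; \<open>c < k\<close> makes \<open>k\<close>
    nonzero.\<close>
  define f where "f = ext_sum True {c..<k} c (cscale (1 / of_nat k) g)"
  have h: "f = cscale (1 / of_nat k) (ext_sum True {c..<k} c g)"
    unfolding f_def ext_sum_cscale ..
  have "cscale (1 / of_nat k) g \<in> sym_alt n k (Suc c)"
    using g(2) by (auto simp: sym_alt_def intro!: skew_cscale tensors_cscale simp del: times_divide_eq_left)
  then have "f \<in> sym_alt n k c" unfolding f_def using assms by (rule koszul_h_sym_alt)
  moreover have "sgn_equivariant n f"
    unfolding f_def using g(3,4) assms
    by (intro sgn_equivariant_ext_sum[of _ n k] sgn_equivariant_cscale tensors_cscale) auto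
  moreover have "koszul_d c f = g"
  proof -
    have ins: "insert c {Suc c..<k} = {c..<k}" using assms by auto
    have "koszul_d c (ext_sum True {c..<k} c g) = cscale (of_nat k) g"
      using cycles_homotopy[OF g(1), of c] assms by (simp add: ins)
    then show ?thesis
      unfolding h ext_sum_cscale using assms by (simp add: fun_eq_iff)
  qed
  ultimately show "g \<in> koszul_d c ` {f \<in> sym_alt n k c. sgn_equivariant n f}" by blast
qed

section \<open>The Weyl module of a hook\<close>

lemma sum_list_hook: "sum_list (hook a b) = Suc a + b"
  by (simp add: hook_def sum_list_replicate)

lemma sum_list_take_hook: "sum_list (take (Suc i) (hook a b)) = Suc a + min i b"
  by (simp add: hook_def sum_list_replicate)

text \<open>Boxes \<open>0, ..., a\<close> fill the first row, and truncated subtraction gives them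
  row 0; each later box \<open>a + i\<close> is alone in row \<open>i\<close>.\<close>

lemma row_of_hook:
  assumes "m < Suc a + b"
  shows "row_of (hook a b) m = m - a"
  unfolding row_of_def sum_list_take_hook
  by (rule Least_equality) (use assms in auto)

lemma col_of_hook:
  assumes "m < Suc a + b"
  shows "col_of (hook a b) m = (if m \<le> a then m else 0)"
proof (cases "m \<le> a")
  case False
  then have "m - a = Suc (m - a - 1)" by simp
  then have "sum_list (take (m - a) (hook a b)) = Suc a + min (m - a - 1) b"
    by (metis sum_list_take_hook)
  then show ?thesis using False assms by (simp add: col_of_def row_of_hook)
qed (use assms in \<open>simp add: col_of_def row_of_hook\<close>)

lemma row_group_hook: "row_group (hook a b) = {p. p permutes {..<Suc a}}"
proof (intro equalityI subsetI CollectI)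
  fix p assume "p \<in> row_group (hook a b)"
  then have p: "p permutes {..<Suc a + b}" "\<And>m. m < Suc a + b \<Longrightarrow> row_of (hook a b) (p m) = row_of (hook a b) m"
    by (auto simp: row_group_def sum_list_hook)
  show "p permutes {..<Suc a}"
  proof (rule permutes_superset[OF p(1)])
    fix m assume m: "m \<in> {..<Suc a + b} - {..<Suc a}"
    then have "p m < Suc a + b" using permutes_in_image[OF p(1), of m] by simp
    then have "p m - a = m - a" using p(2)[of m] m by (simp add: row_of_hook)
    then show "p m = m" using m by auto
  qed
next
  fix p assume "p \<in> {p. p permutes {..<Suc a}}"
  then have p: "p permutes {..<Suc a}" by simp
  then have pk: "p permutes {..<Suc a + b}" by (rule permutes_subset) auto
  have "row_of (hook a b) (p m) = row_of (hook a b) m" if m: "m < Suc a + b" for m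
  proof -
    have "p m < Suc a + b" using permutes_in_image[OF pk, of m] m by simp
    moreover have "p m - a = m - a"
      using permutes_in_image[OF p, of m] permutes_not_in[OF p, of m] by (cases "m < Suc a") auto
    ultimately show ?thesis using m by (simp add: row_of_hook)
  qed
  then show "p \<in> row_group (hook a b)" using pk by (simp add: row_group_def sum_list_hook)
qed

text \<open>The leg lies below the corner \<open>0\<close>; each of the boxes
  \<open>1, ..., a\<close> is alone in its column and must be fixed.\<close>

lemma col_group_hook: "col_group (hook a b) = {q. q permutes insert 0 {Suc a..<Suc a + b}}"
proof (intro equalityI subsetI CollectI)
  fix p assume "p \<in> col_group (hook a b)"
  then have p: "p permutes {..<Suc a + b}" "\<And>m. m < Suc a + b \<Longrightarrow> col_of (hook a b) (p m) = col_of (hook a b) m"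
    by (auto simp: col_group_def sum_list_hook)
  show "p permutes insert 0 {Suc a..<Suc a + b}"
  proof (rule permutes_superset[OF p(1)])
    fix m assume m: "m \<in> {..<Suc a + b} - insert 0 {Suc a..<Suc a + b}"
    then have "p m < Suc a + b" using permutes_in_image[OF p(1), of m] by simp
    moreover have "m < Suc a + b" "0 < m" "m \<le> a" using m by auto
    ultimately have "(if p m \<le> a then p m else 0) = m" using p(2)[of m] by (simp add: col_of_hook)
    then show "p m = m" using m by (auto split: if_splits)
  qed
next
  fix p assume "p \<in> {p. p permutes insert 0 {Suc a..<Suc a + b}}"
  then have p: "p permutes insert 0 {Suc a..<Suc a + b}" by simp
  then have pk: "p permutes {..<Suc a + b}" by (rule permutes_subset) auto
  have "col_of (hook a b) (p m) = col_of (hook a b) m" if m: "m < Suc a + b" for m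
  proof -
    have "p m < Suc a + b" using permutes_in_image[OF pk, of m] m by simp
    moreover have "(if p m \<le> a then p m else 0) = (if m \<le> a then m else 0)"
      using permutes_in_image[OF p, of m] permutes_not_in[OF p, of m] m
      by (cases "m \<in> insert 0 {Suc a..<Suc a + b}") auto
    ultimately show ?thesis using m by (simp add: col_of_hook)
  qed
  then show "p \<in> col_group (hook a b)" using pk by (simp add: col_group_def sum_list_hook)
qed

lemma young_sym_hook:
  assumes f: "f \<in> tensors n (Suc a + b)"
  shows "young_sym (hook a b) f = avg False {..<Suc a} (avg True (insert 0 {Suc a..<Suc a + b}) f)"
proof
  fix w
  have "pos_act p (pos_act q f) w = pos_act (p \<circ> q) f w" if "q permutes insert 0 {Suc a..<Suc a + b}" for p q
    by (subst pos_act_comp[OF f permutes_subset[OF that]]) auto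
  then show "young_sym (hook a b) f w =
      avg False {..<Suc a} (avg True (insert 0 {Suc a..<Suc a + b}) f) w"
    by (simp add: young_sym_def avg_def row_group_hook col_group_hook pos_act_sum chr_def
        del: lessThan_Suc)
qed

text \<open>The column sum makes a tensor alternate on corner and leg, the row sum preserves this on
  the leg and yields a cycle. Conversely, the symmetrizer is a nonzero scalar on cycles.\<close>

lemma weyl_module_hook: "weyl_module n (hook a b) = cycles n (Suc a + b) (Suc a)"
proof -
  define k where "k = Suc a + b"
  define C where "C = {Suc a..<k}"
  have sub: "{..<Suc a} \<subseteq> {..<k}" "C \<subseteq> {..<k}" "insert 0 C \<subseteq> {..<k}" "{..<Suc a} \<inter> C = {}"
    by (auto simp: k_def C_def)
  have ys: "young_sym (hook a b) f = avg False {..<Suc a} (avg True (insert 0 C) f)"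
    if "f \<in> tensors n k" for f
    using young_sym_hook[of f n a b] that by (simp add: k_def C_def)
  have "young_sym (hook a b) f \<in> cycles n k (Suc a)" if f: "f \<in> tensors n k" for f
  proof -
    define g where "g = avg True (insert 0 C) f"
    define v where "v = avg False {..<Suc a} g"
    have g: "g \<in> tensors n k" "skew True (insert 0 C) g"
      unfolding g_def using f sub by (auto intro: tensors_avg skew_avg)
    have v: "v \<in> tensors n k" "skew False {..<Suc a} v" "skew True C v"
      unfolding v_def using g sub
      by (auto intro!: tensors_avg skew_avg skew_avg_disjoint[of _ n k] intro: skew_mono[OF g(2)] simp del: lessThan_Suc)
    have "koszul_d (Suc a) v = (\<lambda>w. 0)" if c: "Suc a < k"
    proof (rule koszul_d_zeroI[OF v(1,2) c])
      fix w
      have sub2: "{..<Suc (Suc a)} \<subseteq> {..<k}" using c by auto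
      \<comment> \<open>The average over one more position absorbs \<open>p\<close>, and it covers
        the positions \<open>0\<close> and \<open>Suc a\<close>, in which \<open>g\<close>
        alternates.\<close>
      have *: "avg False {..<Suc (Suc a)} (pos_act p g) w = 0" if p: "p permutes {..<Suc a}" for p
      proof -
        have "p permutes {..<Suc (Suc a)}" using p by (rule permutes_subset) auto
        then have "avg False {..<Suc (Suc a)} (pos_act p g) w = avg False {..<Suc (Suc a)} g w"
          using avg_pos_act[OF g(1) sub2, of p False] by simp
        also have "\<dots> = 0"
          by (rule avg_False_alternating[OF g, of 0 "Suc a"]) (use c in \<open>auto simp: C_def\<close>)
        finally show ?thesis .
      qed
      show "avg False {..<Suc (Suc a)} v w = 0"
        unfolding v_def avg_def[of False "{..<Suc a}"] avg_sum using * by (simp del: lessThan_Suc)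
    qed
    then have "v \<in> cycles n k (Suc a)" using v by (simp add: cycles_def sym_alt_def C_def del: lessThan_Suc)
    then show ?thesis using ys[OF f] by (simp add: v_def g_def)
  qed
  moreover have "f \<in> young_sym (hook a b) ` tensors n k" if f: "f \<in> cycles n k (Suc a)" for f
  proof -
    have ft: "f \<in> tensors n k" "skew False {..<Suc a} f" "skew True C f"
      using f by (auto simp: cycles_def sym_alt_def C_def)
    \<comment> \<open>The factorials come from collapsing the two averages to coset sums with pivot
      0, the factor \<open>k\<close> from the homotopy identity.\<close>
    define s :: complex where "s = fact a * fact b * of_nat k"
    have s: "s \<noteq> 0" unfolding s_def k_def by (simp del: of_nat_Suc of_nat_add)
    have "insert 0 C - {0} = C" by (auto simp: C_def)
    then have 1: "avg True (insert 0 C) f = cscale (fact b) (ext_sum True (insert 0 C) 0 f)"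
      using avg_eq_ext_sum[of f n k True "insert 0 C" 0] ft sub by (simp add: C_def k_def)
    let ?h = "ext_sum True (insert 0 C) 0 f"
    have h: "?h \<in> tensors n k" using ft sub by (intro tensors_ext_sum) auto
    have "skew False ({..<Suc a} - {0}) ?h"
      using ft(1) sub by (intro skew_ext_sum_disjoint[of _ n k] skew_mono[OF ft(2)]) (auto simp: C_def)
    then have 2: "avg False {..<Suc a} ?h = cscale (fact a) (ext_sum False {..<Suc a} 0 ?h)"
      using avg_eq_ext_sum[of ?h n k False "{..<Suc a}" 0] h sub by (simp del: lessThan_Suc)
    have 3: "ext_sum False {..<Suc a} 0 ?h = cscale (of_nat k) f"
      unfolding C_def by (rule cycles_homotopy[OF f]) (auto simp: k_def)
    have "young_sym (hook a b) f = cscale s f"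
      unfolding ys[OF ft(1)] 1 avg_cscale 2 3 by (simp add: s_def mult_ac)
    moreover have "young_sym (hook a b) (cscale (1 / s) f) = cscale (1 / s) (young_sym (hook a b) f)"
      unfolding ys[OF ft(1)] ys[OF tensors_cscale[OF ft(1)]] avg_cscale ..
    ultimately have "young_sym (hook a b) (cscale (1 / s) f) = f" using s by (simp add: fun_eq_iff)
    then show ?thesis using tensors_cscale[OF ft(1), of "1/s"] by (metis image_eqI)
  qed
  ultimately show ?thesis unfolding weyl_module_def sum_list_hook by (auto simp: k_def)
qed

section \<open>Linear algebra of functions\<close>

interpretation fs: vector_space cscale
  by unfold_locales (auto simp: fun_eq_iff algebra_simps)

lemma sum_fun_apply: "(\<Sum>i\<in>A. F i) w = (\<Sum>i\<in>A. F i w)" for F :: "'i \<Rightarrow> 'w \<Rightarrow> complex"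
  by (induction A rule: infinite_finite_induct) auto

text \<open>A basis \<open>B0\<close> of the kernel is extended to a basis \<open>B\<close> of
  \<open>S\<close>; then \<open>B - B0\<close> maps to a basis of the image. The ambient function
  space has infinite dimension, so finiteness is asked of \<open>S\<close> alone, through
  \<open>T\<close>.\<close>

lemma rank_nullity:
  assumes lin: "Vector_Spaces.linear cscale cscale d" and S: "fs.subspace S"
    and T: "finite T" "S \<subseteq> fs.span T"
  shows "fs.dim S = fs.dim {x \<in> S. d x = 0} + fs.dim (d ` S)"
proof -
  interpret d: Vector_Spaces.linear cscale cscale d by fact
  let ?N = "{x \<in> S. d x = 0}"
  obtain B0 where B0: "B0 \<subseteq> ?N" "fs.independent B0" "?N \<subseteq> fs.span B0"
    by (rule fs.maximal_independent_subset)
  obtain B where B: "B0 \<subseteq> B" "B \<subseteq> S" "fs.independent B" "S \<subseteq> fs.span B"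
    using fs.maximal_independent_subset_extend[of B0 S] B0 by auto
  have fin: "finite B"
    using fs.independent_span_bound[OF T(1) B(3)] B(2) T(2) by auto
  have spanS: "fs.span (B - B0) \<subseteq> S"
    using fs.span_minimal[OF _ S, of "B - B0"] B(2) by auto
  have "x = 0" if x: "x \<in> fs.span (B - B0)" "d x = 0" for x
  proof -
    have xB0: "x \<in> fs.span B0" using x spanS B0(3) by auto
    \<comment> \<open>The coordinates of \<open>x\<close> in \<open>B\<close> are supported both on
      \<open>B0\<close> and on \<open>B - B0\<close>, hence all vanish.\<close>
    have "fs.representation B x = fs.representation B0 x"
      by (rule fs.representation_extend[OF B(3) xB0 B(1)])
    moreover have "fs.representation B x = fs.representation (B - B0) x"
      by (rule fs.representation_extend[OF B(3) x(1)]) auto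
    ultimately have "fs.representation B x b = 0" for b
      using fs.representation_ne_zero[of B0 x b] fs.representation_ne_zero[of "B - B0" x b] by auto
    moreover have "x \<in> fs.span B" using xB0 fs.span_mono[OF B(1)] by auto
    ultimately show "x = 0"
      using fs.sum_nonzero_representation_eq[OF B(3), of x] by simp
  qed
  then have inj: "inj_on d (fs.span (B - B0))"
    by (simp add: d.inj_on_iff_eq_0)
  have ind: "fs.independent (d ` (B - B0))"
    by (rule d.independent_injective_image[OF fs.independent_mono[OF B(3)] inj]) auto
  have "d x \<in> fs.span (d ` (B - B0))" if "x \<in> S" for x
  proof -
    have "x \<in> fs.span (B0 \<union> (B - B0))" using that B(1,4) by (auto simp: Un_absorb1)
    then obtain y z where yz: "x = y + z" "y \<in> fs.span B0" "z \<in> fs.span (B - B0)"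
      unfolding fs.span_Un by blast
    have "d y = 0" by (rule d.eq_0_on_span[OF _ yz(2)]) (use B0(1) in auto)
    then show ?thesis using yz by (simp add: d.add d.span_image)
  qed
  then have "card (d ` (B - B0)) = fs.dim (d ` S)"
    using ind B(2) by (intro fs.basis_card_eq_dim) auto
  moreover have "card (d ` (B - B0)) = card (B - B0)"
    by (rule card_image[OF inj_on_subset[OF inj fs.span_superset]])
  moreover have "card B0 = fs.dim ?N" using B0 by (intro fs.basis_card_eq_dim) auto
  moreover have "card B = fs.dim S" using B by (intro fs.basis_card_eq_dim) auto
  moreover have "card B = card B0 + card (B - B0)"
    using fin B(1) by (metis card_Diff_subset card_mono finite_subset le_add_diff_inverse)
  ultimately show ?thesis by simp
qed

text \<open>Values at the points of \<open>I\<close> separate the elements of \<open>S\<close>, and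
  \<open>e\<close> is dual to these evaluations up to nonzero scalars; so interpolation at
  \<open>I\<close> recovers every element.\<close>

lemma evaluation_basis:
  assumes S: "fs.subspace S" and I: "finite I"
    and inj: "\<And>f. f \<in> S \<Longrightarrow> (\<And>x. x \<in> I \<Longrightarrow> f x = 0) \<Longrightarrow> f = 0"
    and e: "\<And>x. x \<in> I \<Longrightarrow> e x \<in> S" "\<And>x. x \<in> I \<Longrightarrow> e x x \<noteq> 0"
      "\<And>x y. x \<in> I \<Longrightarrow> y \<in> I \<Longrightarrow> x \<noteq> y \<Longrightarrow> e x y = 0"
  shows "S \<subseteq> fs.span (e ` I)" "fs.dim S = card I"
proof -
  have inj_e: "inj_on e I" by (intro inj_onI) (metis e(2,3))
  show span: "S \<subseteq> fs.span (e ` I)"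
  proof
    fix f assume f: "f \<in> S"
    define g where "g = (\<Sum>x\<in>I. cscale (f x / e x x) (e x))"
    have g: "g \<in> fs.span (e ` I)"
      unfolding g_def by (intro fs.span_sum fs.span_scale fs.span_base) auto
    have "g \<in> S" unfolding g_def by (intro fs.subspace_sum[OF S] fs.subspace_scale[OF S] e(1))
    moreover have "g y = f y" if y: "y \<in> I" for y
    proof -
      have "g y = (\<Sum>x\<in>I. if x = y then f y else 0)"
        unfolding g_def sum_fun_apply by (rule sum.cong) (use y e(2,3) in auto)
      then show ?thesis using y I by simp
    qed
    ultimately have "f - g = 0" using f by (intro inj fs.subspace_diff[OF S]) auto
    then show "f \<in> fs.span (e ` I)" using g by simp
  qed
  have "fs.independent (e ` I)"
    unfolding fs.dependent_finite[OF finite_imageI[OF I]]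
  proof clarify
    fix u y assume s: "(\<Sum>v\<in>e ` I. cscale (u v) v) = 0" and y: "y \<in> I" "u (e y) \<noteq> 0"
    have "0 = (\<Sum>x\<in>I. cscale (u (e x)) (e x)) y"
      using s by (simp add: sum.reindex[OF inj_e])
    also have "\<dots> = (\<Sum>x\<in>I. if x = y then u (e y) * e y y else 0)"
      unfolding sum_fun_apply by (rule sum.cong) (use y e(3) in auto)
    also have "\<dots> = u (e y) * e y y" using y I by simp
    finally show False using y e(2) by auto
  qed
  then have "card (e ` I) = fs.dim S" using span e(1) by (intro fs.basis_card_eq_dim) auto
  then show "fs.dim S = card I" by (simp add: card_image[OF inj_e])
qed

section \<open>Pairs of sequences\<close>

definition pairs :: "nat \<Rightarrow> nat \<Rightarrow> nat \<Rightarrow> (nat list \<times> nat list) set" where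
  "pairs n b c = {(lam, mu). length lam = b \<and> sorted_wrt (\<ge>) lam \<and>
     length mu = n - b \<and> sorted_wrt (>) mu \<and> sum_list lam + sum_list mu = c}"

definition top_pairs :: "nat \<Rightarrow> nat \<Rightarrow> nat \<Rightarrow> (nat list \<times> nat list) set" where
  "top_pairs n b c = {(lam, mu) \<in> pairs n b c. b = 0 \<or> mu ! 0 > lam ! 0}"

lemma finite_pairs: "finite (pairs n b c)"
proof (rule finite_subset)
  show "pairs n b c \<subseteq> {xs. set xs \<subseteq> {..c} \<and> length xs = b} \<times> {xs. set xs \<subseteq> {..c} \<and> length xs = n - b}"
    by (auto simp: pairs_def dest!: member_le_sum_list)
qed (intro finite_cartesian_product finite_lists_length_eq; simp)

text \<open>If \<open>\<lambda>\<^sub>1 \<ge> \<mu>\<^sub>1\<close>, the moved part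
  \<open>\<lambda>\<^sub>1 + 1\<close> exceeds both \<open>\<mu>\<^sub>1\<close> and
  \<open>\<lambda>\<^sub>2\<close>, so the new \<open>\<mu>\<close> is strict and the new pair is a
  top pair. Conversely, in a top pair \<open>\<mu>\<^sub>1 - 1\<close> is at least
  \<open>\<lambda>\<^sub>1\<close> and \<open>\<mu>\<^sub>2\<close>.\<close>

lemma card_pairs:
  assumes "Suc b < n"
  shows "card (pairs n (Suc b) c) = card (top_pairs n (Suc b) c) + card (top_pairs n b (Suc c))"
proof -
  have "bij_betw (\<lambda>(lam, mu). (tl lam, Suc (hd lam) # mu))
      (pairs n (Suc b) c - top_pairs n (Suc b) c) (top_pairs n b (Suc c))"
  proof (rule bij_betw_byWitness[where f' = "\<lambda>(lam, mu). ((hd mu - 1) # lam, tl mu)"])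
    show "\<forall>x\<in>pairs n (Suc b) c - top_pairs n (Suc b) c.
       (case case x of (lam, mu) \<Rightarrow> (tl lam, Suc (hd lam) # mu) of
        (lam, mu) \<Rightarrow> ((hd mu - 1) # lam, tl mu)) = x"
      by (auto simp: pairs_def length_Suc_conv)
    \<comment> \<open>A first part 0 would force \<open>mu = [0]\<close> by strictness and
      \<open>b = 0\<close> by the top condition, hence size 0 instead of
      \<open>Suc c\<close>.\<close>
    have pos: "\<exists>x mu'. mu = Suc x # mu'" if mem: "(lam, mu) \<in> top_pairs n b (Suc c)" for lam mu
    proof -
      have l: "length lam = b" "length mu = n - b" "sorted_wrt (>) mu" "sum_list lam + sum_list mu = Suc c"
        "b = 0 \<or> mu ! 0 > lam ! 0"
        using mem by (auto simp: top_pairs_def pairs_def)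
      obtain x mu' where mu: "mu = x # mu'" using l(2) assms by (cases mu) auto
      have "x \<noteq> 0"
      proof
        assume "x = 0"
        then have "mu' = []" using l(3) mu by (cases mu') auto
        moreover have "b = 0" using l(5) mu \<open>x = 0\<close> by auto
        ultimately show False using l mu \<open>x = 0\<close> by auto
      qed
      then show ?thesis using mu by (cases x) auto
    qed
    then show "\<forall>x\<in>top_pairs n b (Suc c).
       (case case x of (lam, mu) \<Rightarrow> ((hd mu - 1) # lam, tl mu) of
        (lam, mu) \<Rightarrow> (tl lam, Suc (hd lam) # mu)) = x"
      by fastforce
    show "(\<lambda>(lam, mu). (tl lam, Suc (hd lam) # mu)) ` (pairs n (Suc b) c - top_pairs n (Suc b) c)
        \<subseteq> top_pairs n b (Suc c)"
    proof (clarify)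
      fix lam mu assume mem: "(lam, mu) \<in> pairs n (Suc b) c" "(lam, mu) \<notin> top_pairs n (Suc b) c"
      then obtain x lam' where lam: "lam = x # lam'" by (cases lam) (auto simp: pairs_def)
      obtain y mu' where mu: "mu = y # mu'" using mem assms by (cases mu) (auto simp: pairs_def)
      have "y \<le> x" using mem lam mu by (auto simp: top_pairs_def)
      then show "(tl lam, Suc (hd lam) # mu) \<in> top_pairs n b (Suc c)"
        using mem(1) assms unfolding lam mu
        by (cases lam') (auto simp: top_pairs_def pairs_def le_imp_less_Suc)
    qed
    show "(\<lambda>(lam, mu). ((hd mu - 1) # lam, tl mu)) ` top_pairs n b (Suc c)
        \<subseteq> pairs n (Suc b) c - top_pairs n (Suc b) c"
    proof (clarify)
      fix lam mu assume mem: "(lam, mu) \<in> top_pairs n b (Suc c)"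
      obtain x mu' where mu: "mu = Suc x # mu'" using pos[OF mem] by blast
      \<comment> \<open>By \<open>Suc b < n\<close> the list \<open>mu\<close> has at least two
        parts, so one is left to compare with the new first part of \<open>lam\<close>.\<close>
      have "mu' \<noteq> []" using mem mu assms by (auto simp: top_pairs_def pairs_def)
      then obtain y mu'' where mu': "mu' = y # mu''" by (cases mu') auto
      show "((hd mu - 1) # lam, tl mu) \<in> pairs n (Suc b) c - top_pairs n (Suc b) c"
        using mem unfolding mu mu'
        by (cases lam) (auto simp: top_pairs_def pairs_def)
    qed
  qed
  then have "card (top_pairs n b (Suc c)) = card (pairs n (Suc b) c - top_pairs n (Suc b) c)"
    using bij_betw_same_card by fastforce
  moreover have "top_pairs n (Suc b) c \<subseteq> pairs n (Suc b) c" by (auto simp: top_pairs_def)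
  ultimately show ?thesis
    using finite_pairs[of n "Suc b" c] card_mono[of "pairs n (Suc b) c" "top_pairs n (Suc b) c"]
    by (simp add: card_Diff_subset finite_subset)
qed

section \<open>Sign-equivariant tensors\<close>

definition sgn_sym_alt :: "nat \<Rightarrow> nat \<Rightarrow> nat \<Rightarrow> (nat list \<Rightarrow> complex) set" where
  "sgn_sym_alt n k c = {f \<in> sym_alt n k c. sgn_equivariant n f}"

definition letters :: "nat list \<Rightarrow> nat list" where
  "letters al = concat (map (\<lambda>i. replicate (al ! i) i) [0..<length al])"

text \<open>
  The word representing the orbit of \<open>(\<lambda>, \<mu>)\<close>: letter \<open>i\<close> occurs \<open>(\<lambda> @ \<mu>) ! i\<close> times in the symmetric
  block, and the alternating block is filled with the letters \<open>0, \<dots>, b - 1\<close>.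
\<close>

definition pair_word :: "nat list \<times> nat list \<Rightarrow> nat list" where
  "pair_word = (\<lambda>(lam, mu). letters (lam @ mu) @ [0..<length lam])"

lemma count_mset_map_inj: "inj h \<Longrightarrow> count (mset (map h xs)) (h x) = count (mset xs) x"
  by (induction xs) (auto dest: injD)

lemma count_letters: "count (mset (letters al)) x = (if x < length al then al ! x else 0)"
proof -
  have "count (mset (concat (map (\<lambda>i. replicate (g i) i) [0..<m]))) x = (if x < m then g x else 0)"
    for g and m :: nat
    by (induction m) auto
  then show ?thesis by (simp add: letters_def)
qed

lemma length_letters: "length (letters al) = sum_list al"
proof -
  have "length (letters al) = sum_list (map ((!) al) [0..<length al])"
    by (simp add: letters_def length_concat o_def)
  then show ?thesis by (simp add: map_nth)
qed

lemma set_letters: "set (letters al) \<subseteq> {..<length al}"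
  by (auto simp: letters_def)

lemma subspace_sgn_sym_alt: "fs.subspace (sgn_sym_alt n k c)"
proof (rule fs.subspaceI)
  show "0 \<in> sgn_sym_alt n k c"
    by (simp add: sgn_sym_alt_def sym_alt_def tensors_def skew_def sgn_equivariant_def pos_act_def
        perm_mat_act_def fun_eq_iff)
next
  fix f g assume "f \<in> sgn_sym_alt n k c" "g \<in> sgn_sym_alt n k c"
  moreover have "f + g \<in> tensors n k" if "f \<in> tensors n k" "g \<in> tensors n k"
    using that unfolding tensors_def mem_Collect_eq plus_fun_apply by (metis add.left_neutral)
  moreover have "pos_act \<sigma> (f + g) = pos_act \<sigma> f + pos_act \<sigma> g"
    "perm_mat_act \<sigma> (f + g) = perm_mat_act \<sigma> f + perm_mat_act \<sigma> g" for \<sigma>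
    by (auto simp: pos_act_def perm_mat_act_def)
  ultimately show "f + g \<in> sgn_sym_alt n k c"
    by (auto simp: sgn_sym_alt_def sym_alt_def skew_def sgn_equivariant_def fun_eq_iff algebra_simps)
next
  fix a f assume "f \<in> sgn_sym_alt n k c"
  then show "cscale a f \<in> sgn_sym_alt n k c"
    by (auto simp: sgn_sym_alt_def sym_alt_def intro: tensors_cscale skew_cscale sgn_equivariant_cscale)
qed

section \<open>Determination by the values on orbit representatives\<close>

lemma sym_alt_rearrange_left:
  assumes f: "f \<in> sym_alt n k c" and x: "length x = c" "mset x = mset x'" and y: "length y = k - c" "c \<le> k"
  shows "f (x @ y) = f (x' @ y)"
proof -
  have lx: "length x' = c" using x mset_eq_length by metis
  obtain p where p: "p permutes {..<length x'}" "permute_list p x' = x"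
    using mset_eq_permutation[OF x(2)] by blast
  have pk: "p permutes {..<length (x' @ y)}" using p(1) by (rule permutes_subset) auto
  have "permute_list p (x' @ y) = x @ y"
  proof (rule nth_equalityI)
    fix i assume i: "i < length (permute_list p (x' @ y))"
    then have nth: "permute_list p (x' @ y) ! i = (x' @ y) ! p i" by (intro permute_list_nth[OF pk]) simp
    show "permute_list p (x' @ y) ! i = (x @ y) ! i"
    proof (cases "i < c")
      case True
      then have "p i < c" using permutes_in_image[OF p(1), of i] lx by simp
      then have "(x' @ y) ! p i = permute_list p x' ! i"
        using True lx by (simp add: permute_list_nth[OF p(1)] nth_append)
      then show ?thesis using nth True x(1) p(2) by (simp add: nth_append)
    next
      case False
      then have "p i = i" using p(1) lx by (simp add: permutes_not_in)
      then show ?thesis using nth False x(1) lx by (simp add: nth_append)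
    qed
  qed (use lx x in simp)
  moreover have "pos_act p f (x' @ y) = f (x' @ y)"
    using f p(1) lx by (simp add: sym_alt_def skew_def)
  ultimately show ?thesis by (simp add: pos_act_permute_list)
qed

text \<open>Rearranging the alternating block changes \<open>f\<close> only by a sign, so vanishing
  transfers. The shift \<open>(+) c\<close> transports permutations of \<open>y'\<close> to the
  positions of that block.\<close>

lemma sym_alt_rearrange_right:
  assumes f: "f \<in> sym_alt n (c + b) c" and x: "length x = c" and y: "length y = b" "mset y = mset y'"
    and z: "f (x @ y') = 0"
  shows "f (x @ y) = 0"
proof -
  have ly: "length y' = b" using y mset_eq_length by metis
  obtain q where q: "q permutes {..<length y'}" "permute_list q y' = y"
    using mset_eq_permutation[OF y(2)] by blast
  define q' where "q' = map_permutation {..<b} ((+) c) q"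
  have bij: "bij_betw ((+) c) {..<b} {c..<c + b}"
    by (rule bij_betw_byWitness[where f' = "\<lambda>i. i - c"]) auto
  have q': "q' permutes {c..<c + b}"
    unfolding q'_def by (rule map_permutation_permutes[OF bij]) (use q ly in simp)
  have qk: "q' permutes {..<length (x @ y')}" using q' by (rule permutes_subset) (use x ly in auto)
  have "permute_list q' (x @ y') = x @ y"
  proof (rule nth_equalityI)
    fix i assume i: "i < length (permute_list q' (x @ y'))"
    then have nth: "permute_list q' (x @ y') ! i = (x @ y') ! q' i" by (intro permute_list_nth[OF qk]) simp
    show "permute_list q' (x @ y') ! i = (x @ y) ! i"
    proof (cases "i < c")
      case True
      then have "q' i = i" using q' by (simp add: permutes_not_in)
      then show ?thesis using nth True x by (simp add: nth_append)
    next
      case False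
      then have j: "i = c + (i - c)" "i - c < b" using i x ly by auto
      define j where "j = i - c"
      note j = j[folded j_def]
      have "q' i = c + q j"
        unfolding q'_def j(1) using j(2) by (subst map_permutation_apply) auto
      then have "permute_list q' (x @ y') ! i = permute_list q y' ! j"
        using nth j ly x by (simp add: permute_list_nth[OF q(1)] nth_append)
      then show ?thesis using j x q(2) by (simp add: nth_append)
    qed
  qed (use ly x y in simp)
  moreover have "pos_act q' f (x @ y') = chr True q' * f (x @ y')"
    using f q' by (simp add: sym_alt_def skew_def)
  ultimately show ?thesis using z by (simp add: pos_act_permute_list)
qed

text \<open>Swapping two equal letters of the alternating block fixes the word but negates
  \<open>f\<close>.\<close>

lemma alternating_distinct:
  assumes f: "f \<in> sym_alt n k c" and w: "f w \<noteq> 0"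
  shows "distinct (drop c w)"
proof (rule ccontr)
  have len: "length w = k" using f w by (auto simp: sym_alt_def tensors_def)
  assume "\<not> distinct (drop c w)"
  then obtain i j where ij: "i < length w - c" "j < length w - c" "i \<noteq> j" "drop c w ! i = drop c w ! j"
    by (auto simp: distinct_conv_nth)
  have eq: "w ! (c + i) = w ! (c + j)" using ij by (auto simp: nth_drop)
  let ?\<sigma> = "transpose (c + i) (c + j)"
  have \<sigma>: "?\<sigma> permutes {c..<k}" using ij len by (intro permutes_swap_id) auto
  have \<sigma>k: "?\<sigma> permutes {..<length w}" using \<sigma> by (rule permutes_subset) (use len in auto)
  have "permute_list ?\<sigma> w = w"
    by (rule nth_equalityI) (use eq in \<open>auto simp: permute_list_nth[OF \<sigma>k] transpose_def\<close>)
  moreover have "pos_act ?\<sigma> f w = chr True ?\<sigma> * f w"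
    using f \<sigma> by (simp add: sym_alt_def skew_def)
  ultimately show False using w ij(3) by (simp add: chr_transpose pos_act_permute_list)
qed

text \<open>This is why \<open>\<mu>\<close> is strict: if two letters off the alternating block had
  equal multiplicity, swapping them would only rearrange the symmetric block, while
  sign-equivariance negates \<open>f\<close>.\<close>

lemma sgn_sym_alt_inj_multiplicity:
  assumes f: "f \<in> sgn_sym_alt n k c" and ck: "c \<le> k" and w: "f w \<noteq> 0"
  shows "inj_on (count (mset (take c w))) ({..<n} - set (drop c w))"
proof (rule inj_onI, rule ccontr)
  fix z z' assume z: "z \<in> {..<n} - set (drop c w)" "z' \<in> {..<n} - set (drop c w)"
    "count (mset (take c w)) z = count (mset (take c w)) z'" "z \<noteq> z'"
  let ?\<pi> = "transpose z z'"
  have fs: "f \<in> sym_alt n k c" "f \<in> tensors n k" "sgn_equivariant n f"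
    using f by (auto simp: sgn_sym_alt_def sym_alt_def)
  have len: "length w = k" using fs w by (auto simp: tensors_def)
  have \<pi>: "?\<pi> permutes {..<n}" using z by (intro permutes_swap_id) auto
  have y: "map ?\<pi> (drop c w) = drop c w"
    using z by (intro map_idI transpose_apply_other) auto
  have "mset (map ?\<pi> (take c w)) = mset (take c w)"
  proof (rule multiset_eqI)
    fix v
    have "count (mset (map ?\<pi> (take c w))) (?\<pi> (?\<pi> v)) = count (mset (take c w)) (?\<pi> v)"
      by (rule count_mset_map_inj) simp
    then show "count (mset (map ?\<pi> (take c w))) v = count (mset (take c w)) v"
      using z(3) by (simp only: transpose_involutory) (auto simp: transpose_def)
  qed
  then have "f (map ?\<pi> (take c w) @ drop c w) = f (take c w @ drop c w)"
    using len ck by (intro sym_alt_rearrange_left[OF fs(1)]) auto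
  then have "f (map ?\<pi> w) = f w"
    using y by (metis append_take_drop_id map_append)
  moreover have "perm_mat_act ?\<pi> f w = of_int (sign ?\<pi>) * f w"
    using fs(3) \<pi> by (simp add: sgn_equivariant_def)
  ultimately show False using w z(4) by (simp add: perm_mat_act_def sign_swap_id)
qed

text \<open>A word with nonzero value is brought to some \<open>pair_word\<close> by relabelling its
  letters and rearranging both blocks, which changes \<open>f\<close> only by signs.\<close>

lemma sgn_sym_alt_eq_0:
  assumes f: "f \<in> sgn_sym_alt n (c + b) c"
    and z: "\<And>p. p \<in> pairs n b c \<Longrightarrow> f (pair_word p) = 0"
  shows "f = 0"
proof (rule ccontr)
  assume "f \<noteq> 0"
  then obtain w where w: "f w \<noteq> 0" by (auto simp: fun_eq_iff)
  have fs: "f \<in> sym_alt n (c + b) c" "f \<in> tensors n (c + b)" "sgn_equivariant n f"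
    using f by (auto simp: sgn_sym_alt_def sym_alt_def)
  define x y where "x = take c w" and "y = drop c w"
  have w_eq: "w = x @ y" by (simp add: x_def y_def)
  have "length w = c + b" "set w \<subseteq> {..<n}" using fs(2) w by (auto simp: tensors_def)
  then have len: "length x = c" "length y = b" and set: "set x \<subseteq> {..<n}" "set y \<subseteq> {..<n}"
    unfolding x_def y_def by (auto dest: in_set_takeD in_set_dropD)
  have dist: "distinct y" using alternating_distinct[OF fs(1) w] by (simp add: y_def)
  define \<alpha> where "\<alpha> = count (mset x)"
  have inj: "inj_on \<alpha> ({..<n} - set y)"
    using sgn_sym_alt_inj_multiplicity[OF f _ w] by (simp add: \<alpha>_def x_def y_def)
  \<comment> \<open>Letters of the alternating block come first, then the others, each group by
    decreasing multiplicity in \<open>x\<close>; the multiplicities in this order form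
    \<open>lam\<close> and \<open>mu\<close>.\<close>
  define L1 where "L1 = rev (sort_key \<alpha> y)"
  define L2 where "L2 = rev (sort_key \<alpha> (sorted_list_of_set ({..<n} - set y)))"
  have L1: "set L1 = set y" "distinct L1" "length L1 = b" using dist len by (auto simp: L1_def)
  have L2: "set L2 = {..<n} - set y" "distinct L2" by (auto simp: L2_def)
  define L where "L = L1 @ L2"
  have L: "set L = {..<n}" "distinct L" using L1 L2 set(2) by (auto simp: L_def)
  then have lenL: "length L = n" by (metis card_lessThan distinct_card)
  define lam mu where "lam = map \<alpha> L1" and "mu = map \<alpha> L2"
  have lam_mu: "lam @ mu = map \<alpha> L" by (simp add: lam_def mu_def L_def)
  have "sorted_wrt (\<ge>) lam"
    by (simp add: lam_def L1_def rev_map[symmetric] sorted_wrt_rev)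
  moreover have "sorted_wrt (>) mu"
  proof -
    let ?s = "sort_key \<alpha> (sorted_list_of_set ({..<n} - set y))"
    have "distinct (map \<alpha> ?s)" using inj by (simp add: distinct_map)
    then have "sorted_wrt (<) (map \<alpha> ?s)" by (simp add: strict_sorted_iff)
    then show ?thesis by (simp add: mu_def L2_def rev_map[symmetric] sorted_wrt_rev)
  qed
  moreover have "length lam = b" "length mu = n - b"
    using L1(3) lenL by (auto simp: lam_def mu_def L_def)
  moreover have "sum_list lam + sum_list mu = c"
  proof -
    have "sum_list lam + sum_list mu = sum_list (map \<alpha> L)" by (metis lam_mu sum_list_append)
    also have "\<dots> = sum \<alpha> {..<n}" using L by (simp add: sum_list_distinct_conv_sum_set)
    also have "\<dots> = sum \<alpha> (set x)"
      using set(1) by (intro sum.mono_neutral_right) (auto simp: \<alpha>_def count_eq_zero_iff)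
    also have "\<dots> = size (mset x)" by (simp add: size_multiset_overloaded_eq \<alpha>_def)
    finally show ?thesis using len by simp
  qed
  ultimately have "(lam, mu) \<in> pairs n b c" by (simp add: pairs_def)
  then have fz: "f (letters (map \<alpha> L) @ [0..<b]) = 0"
    using z[of "(lam, mu)"] by (simp add: pair_word_def lam_mu \<open>length lam = b\<close>)
  \<comment> \<open>The inverse of \<open>\<rho>\<close> relabels each letter by its rank in
    \<open>L\<close>, so the letters of the alternating block become
    \<open>0, ..., b - 1\<close>.\<close>
  define \<rho> where "\<rho> i = (if i < n then L ! i else i)" for i
  have \<rho>: "\<rho> permutes {..<n}"
  proof (rule bij_imp_permutes)
    have "bij_betw ((!) L) {..<n} {..<n}" using bij_betw_nth[OF L(2)] L(1) lenL by auto
    then show "bij_betw \<rho> {..<n} {..<n}" by (rule bij_betw_cong[THEN iffD1, rotated]) (simp add: \<rho>_def)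
  qed (simp add: \<rho>_def)
  have inv\<rho>: "inv \<rho> (\<rho> i) = i" for i using permutes_inverses(2)[OF \<rho>] by simp
  have "mset (map (inv \<rho>) x) = mset (letters (map \<alpha> L))"
  proof (rule multiset_eqI)
    fix i
    have "count (mset (map (inv \<rho>) x)) (inv \<rho> (\<rho> i)) = count (mset x) (\<rho> i)"
      using permutes_inj[OF permutes_inv[OF \<rho>]] by (rule count_mset_map_inj)
    then have "count (mset (map (inv \<rho>) x)) i = count (mset x) (\<rho> i)" by (simp only: inv\<rho>)
    moreover have "count (mset x) i = 0" if "\<not> i < n" using that set by (auto simp: count_eq_zero_iff)
    ultimately show "count (mset (map (inv \<rho>) x)) i = count (mset (letters (map \<alpha> L))) i"
      using lenL by (simp add: count_letters \<rho>_def \<alpha>_def)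
  qed
  then have 1: "f (map (inv \<rho>) x @ map (inv \<rho>) y) = f (letters (map \<alpha> L) @ map (inv \<rho>) y)"
    using len by (intro sym_alt_rearrange_left[OF fs(1)]) auto
  have "set y = \<rho> ` {..<b}"
  proof -
    have "b \<le> n" using lenL L1(3) by (simp add: L_def)
    have "set y = (!) L1 ` {..<b}" using L1 by (metis lessThan_atLeast0 list.set_map map_nth set_upt)
    also have "\<dots> = \<rho> ` {..<b}"
      using \<open>b \<le> n\<close> L1(3) by (intro image_cong) (auto simp: \<rho>_def L_def nth_append)
    finally show ?thesis .
  qed
  then have "set (map (inv \<rho>) y) = {..<b}" by (simp add: image_image inv\<rho>)
  moreover have "distinct (map (inv \<rho>) y)"
    using dist permutes_inj_on[OF permutes_inv[OF \<rho>]] by (simp add: distinct_map)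
  ultimately have "mset (map (inv \<rho>) y) = mset [0..<b]"
    by (subst set_eq_iff_mset_eq_distinct[symmetric]) auto
  moreover have "length (letters (map \<alpha> L)) = c"
    using \<open>sum_list lam + sum_list mu = c\<close> lam_mu by (metis length_letters sum_list_append)
  ultimately have "f (letters (map \<alpha> L) @ map (inv \<rho>) y) = 0"
    using sym_alt_rearrange_right[OF fs(1) _ _ _ fz, of "map (inv \<rho>) y"] len by simp
  then have "f (map (inv \<rho>) w) = 0" using 1 by (simp add: w_eq)
  moreover have "perm_mat_act \<rho> f w = of_int (sign \<rho>) * f w"
    using fs(3) \<rho> by (simp add: sgn_equivariant_def)
  ultimately show False using w by (simp add: perm_mat_act_def)
qed

section \<open>Orbits of words and the dual tensors\<close>

definition letter_avg :: "nat \<Rightarrow> (nat list \<Rightarrow> complex) \<Rightarrow> nat list \<Rightarrow> complex" where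
  "letter_avg n f = (\<lambda>w. \<Sum>\<pi> | \<pi> permutes {..<n}. of_int (sign \<pi>) * perm_mat_act \<pi> f w)"

lemma tensors_perm_mat_act:
  assumes "f \<in> tensors n k" "\<pi> permutes {..<n}"
  shows "perm_mat_act \<pi> f \<in> tensors n k"
  unfolding tensors_def mem_Collect_eq perm_mat_act_def
proof (intro allI impI)
  fix w assume "f (map (inv \<pi>) w) \<noteq> 0"
  then have "length (map (inv \<pi>) w) = k" "set (map (inv \<pi>) w) \<subseteq> {..<n}"
    using assms(1) unfolding tensors_def by blast+
  then show "length w = k \<and> set w \<subseteq> {..<n}"
    using permutes_in_image[OF permutes_inv[OF assms(2)]] by auto
qed

lemma letter_avg_sgn_sym_alt:
  assumes f: "f \<in> sym_alt n k c" and ck: "c \<le> k"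
  shows "letter_avg n f \<in> sgn_sym_alt n k c"
proof -
  have ft: "f \<in> tensors n k" "skew False {..<c} f" "skew True {c..<k} f" using f by (auto simp: sym_alt_def)
  have "letter_avg n f \<in> tensors n k"
    unfolding letter_avg_def by (intro tensors_sum tensors_perm_mat_act[OF ft(1)]) simp
  moreover have "skew e B (letter_avg n f)" if B: "skew e B f" "B \<subseteq> {..<k}" for e B
    unfolding skew_def
  proof (intro allI impI ext)
    fix \<sigma> w assume \<sigma>: "\<sigma> permutes B"
    have "pos_act \<sigma> f = cscale (chr e \<sigma>) f" using B(1) \<sigma> by (simp add: skew_def)
    then have "pos_act \<sigma> (perm_mat_act \<pi> f) w = chr e \<sigma> * perm_mat_act \<pi> f w" for \<pi>
      using perm_mat_act_pos_act[OF ft(1) permutes_subset[OF \<sigma> B(2)], of \<pi>]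
      by (simp add: perm_mat_act_def fun_eq_iff)
    then show "pos_act \<sigma> (letter_avg n f) w = chr e \<sigma> * letter_avg n f w"
      unfolding letter_avg_def pos_act_sum by (simp add: sum_distrib_left mult.left_commute)
  qed
  moreover have "sgn_equivariant n (letter_avg n f)"
    unfolding sgn_equivariant_def
  proof (intro allI impI ext)
    fix \<pi> w assume \<pi>: "\<pi> permutes {..<n}"
    have "of_int (sign \<rho>) * perm_mat_act \<pi> (perm_mat_act \<rho> f) w =
        of_int (sign \<pi>) * (of_int (sign (\<pi> \<circ> \<rho>)) * perm_mat_act (\<pi> \<circ> \<rho>) f w)" if \<rho>: "\<rho> permutes {..<n}" for \<rho>
    proof -
      have "inv (\<pi> \<circ> \<rho>) = inv \<rho> \<circ> inv \<pi>"
        using \<pi> \<rho> by (intro o_inv_distrib) (auto simp: permutes_bij)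
      moreover have "sign (\<pi> \<circ> \<rho>) = sign \<pi> * sign \<rho>"
        using \<pi> \<rho> by (intro sign_compose) (auto intro: permutes_imp_permutation)
      ultimately show ?thesis
        by (cases \<pi> rule: sign_cases) (simp_all add: perm_mat_act_def o_def)
    qed
    then have "perm_mat_act \<pi> (letter_avg n f) w = of_int (sign \<pi>) *
        (\<Sum>\<rho> | \<rho> permutes {..<n}. of_int (sign (\<pi> \<circ> \<rho>)) * perm_mat_act (\<pi> \<circ> \<rho>) f w)"
      by (simp add: letter_avg_def perm_mat_act_sum sum_distrib_left)
    also have "(\<Sum>\<rho> | \<rho> permutes {..<n}. of_int (sign (\<pi> \<circ> \<rho>)) * perm_mat_act (\<pi> \<circ> \<rho>) f w) = letter_avg n f w"
      unfolding letter_avg_def by (rule setum_permutations_compose_left[OF \<pi>, symmetric])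
    finally show "perm_mat_act \<pi> (letter_avg n f) w = of_int (sign \<pi>) * letter_avg n f w" .
  qed
  moreover have "{..<c} \<subseteq> {..<k}" "{c..<k} \<subseteq> {..<k}" using ck by auto
  ultimately show ?thesis using ft by (simp add: sgn_sym_alt_def sym_alt_def)
qed

lemma sorted_wrt_ge_mset_eq:
  fixes xs ys :: "nat list"
  assumes "sorted_wrt (\<ge>) xs" "sorted_wrt (\<ge>) ys" "mset xs = mset ys"
  shows "xs = ys"
proof -
  have "sorted (rev xs)" "sorted (rev ys)" "mset (rev xs) = mset (rev ys)"
    using assms by (auto simp: sorted_wrt_rev)
  then have "rev xs = rev ys" by (metis properties_for_sort)
  then show ?thesis by simp
qed

lemma mset_map_upt_permutes:
  assumes "\<pi> permutes {..<m}"
  shows "mset (map (\<lambda>i. g (\<pi> i)) [0..<m]) = mset (map g [0..<m])"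
proof -
  have "mset (map \<pi> [0..<m]) = mset [0..<m]"
    using permutes_inj_on[OF assms] permutes_image[OF assms]
    by (subst set_eq_iff_mset_eq_distinct[symmetric]) (auto simp: distinct_map lessThan_atLeast0)
  then have "image_mset g (mset (map \<pi> [0..<m])) = image_mset g (mset [0..<m])" by simp
  then show ?thesis by (simp add: multiset.map_comp o_def)
qed

text \<open>Distinct representatives lie in distinct orbits, and the agreement of signs on
  stabilizers rules out cancellation in the orbit sums. The alternating block ties \<open>q\<close>
  to \<open>\<pi>\<close> on \<open>{..<b}\<close>, multiplicities identify the parts, and
  strictness of \<open>mu\<close> fixes the other letters.\<close>

lemma pair_word_orbit:
  assumes P: "(lam, mu) \<in> pairs n b c" "(lam', mu') \<in> pairs n b c" and bn: "b \<le> n"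
    and \<pi>: "\<pi> permutes {..<n}" and p: "p permutes {..<c}" and q: "q permutes {c..<c + b}"
    and eq: "permute_list q (permute_list p (map (inv \<pi>) (pair_word (lam', mu')))) = pair_word (lam, mu)"
  shows "lam = lam'" "mu = mu'" "sign \<pi> = sign q"
proof -
  have l: "length lam = b" "length mu = n - b" "sorted_wrt (\<ge>) lam" "sorted_wrt (>) mu" "sum_list lam + sum_list mu = c"
    and l': "length lam' = b" "length mu' = n - b" "sorted_wrt (\<ge>) lam'" "sorted_wrt (>) mu'" "sum_list lam' + sum_list mu' = c"
    using P by (auto simp: pairs_def)
  define al al' where "al = lam @ mu" and "al' = lam' @ mu'"
  have al: "length al = n" "length (letters al) = c" and al': "length al' = n" "length (letters al') = c"
    using l l' bn by (auto simp: al_def al'_def length_letters)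
  define u where "u = map (inv \<pi>) (letters al' @ [0..<b])"
  have lu: "length u = c + b" using al' by (simp add: u_def)
  have pk: "p permutes {..<length u}" using p by (rule permutes_subset) (simp add: lu)
  have qk: "q permutes {..<length (permute_list p u)}" using q by (rule permutes_subset) (auto simp: lu)
  have eq': "permute_list q (permute_list p u) = letters al @ [0..<b]"
    using eq l l' by (simp add: u_def pair_word_def al_def al'_def)
  \<comment> \<open>Position \<open>c + i\<close> of the target holds the letter \<open>i\<close>,
    and \<open>p\<close> fixes the positions from \<open>c\<close> on; so below \<open>b\<close>,
    \<open>\<pi>\<close> is \<open>q\<close> shifted down by \<open>c\<close>.\<close>
  have inv_q: "inv \<pi> (q (c + i) - c) = i" "q (c + i) - c < b" if i: "i < b" for i
  proof -
    have qi: "q (c + i) \<in> {c..<c + b}" using i permutes_in_image[OF q, of "c + i"] by simp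
    have "i = permute_list q (permute_list p u) ! (c + i)"
      unfolding eq' using al i by (simp add: nth_append)
    also have "\<dots> = permute_list p u ! q (c + i)"
      by (rule permute_list_nth[OF qk]) (use i lu in simp)
    also have "\<dots> = u ! p (q (c + i))"
      by (rule permute_list_nth[OF pk]) (use qi lu in simp)
    also have "p (q (c + i)) = q (c + i)" using p qi by (intro permutes_not_in) auto
    also have "u ! q (c + i) = inv \<pi> (q (c + i) - c)"
      using qi al' by (auto simp: u_def nth_append)
    finally show "inv \<pi> (q (c + i) - c) = i" by simp
    show "q (c + i) - c < b" using qi by auto
  qed
  have \<pi>_q: "\<pi> i = q (c + i) - c" if "i < b" for i
    using inv_q(1)[OF that] permutes_inverses(1)[OF \<pi>] by metis
  have \<pi>b: "\<pi> i < b" if "i < b" for i using \<pi>_q[OF that] inv_q(2)[OF that] by simp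
  have "mset (permute_list q (permute_list p u)) = mset u"
    using mset_permute_list[OF qk] mset_permute_list[OF pk] by simp
  then have msu: "mset (letters al) + mset [0..<b] = mset (map (inv \<pi>) (letters al')) + mset (map (inv \<pi>) [0..<b])"
    unfolding eq' by (simp add: u_def)
  have image_b: "\<pi> ` {..<b} = {..<b}"
    by (rule endo_inj_surj) (use \<pi>b permutes_inj_on[OF \<pi>] in auto)
  have "inv \<pi> ` {..<b} = {..<b}"
    using image_b permutes_inverses(2)[OF \<pi>] by (metis (no_types, lifting) image_cong image_ident image_image)
  then have "mset (map (inv \<pi>) [0..<b]) = mset [0..<b]"
    using permutes_inj_on[OF permutes_inv[OF \<pi>]]
    by (subst set_eq_iff_mset_eq_distinct[symmetric]) (auto simp: distinct_map lessThan_atLeast0)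
  then have ms: "mset (letters al) = mset (map (inv \<pi>) (letters al'))" using msu by simp
  have al_\<pi>: "al ! i = al' ! \<pi> i" if i: "i < n" for i
  proof -
    have "count (mset (map (inv \<pi>) (letters al'))) (inv \<pi> (\<pi> i)) = count (mset (letters al')) (\<pi> i)"
      using permutes_inj[OF permutes_inv[OF \<pi>]] by (rule count_mset_map_inj)
    moreover have "inv \<pi> (\<pi> i) = i" using permutes_inverses(2)[OF \<pi>] by simp
    moreover have "\<pi> i < n" using permutes_in_image[OF \<pi>, of i] i by simp
    ultimately have "count (mset (letters al)) i = count (mset (letters al')) (\<pi> i)" by (simp only: ms)
    then show ?thesis using i \<open>\<pi> i < n\<close> al al' by (simp add: count_letters)
  qed
  have "mset lam = mset lam'"
  proof -
    \<comment> \<open>At this point \<open>\<pi>\<close> may still move letters from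
      \<open>b\<close> on, so its restriction to \<open>{..<b}\<close> is extended by the
      identity.\<close>
    have perm: "(\<lambda>i. if i < b then \<pi> i else i) permutes {..<b}"
    proof (rule bij_imp_permutes)
      show "bij_betw (\<lambda>i. if i < b then \<pi> i else i) {..<b} {..<b}"
        using image_b permutes_inj_on[OF \<pi>, of "{..<b}"]
        by (auto simp: bij_betw_def inj_on_def cong: image_cong_simp)
    qed simp
    have "lam = map (\<lambda>i. al' ! (if i < b then \<pi> i else i)) [0..<b]"
    proof (rule nth_equalityI)
      fix i assume "i < length lam"
      then show "lam ! i = map (\<lambda>i. al' ! (if i < b then \<pi> i else i)) [0..<b] ! i"
        using al_\<pi>[of i] l(1) bn by (simp add: al_def nth_append)
    qed (simp add: l)
    then have "mset lam = mset (map ((!) al') [0..<b])"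
      using mset_map_upt_permutes[OF perm, of "(!) al'"] by simp
    also have "map ((!) al') [0..<b] = lam'"
      by (rule nth_equalityI) (use l' in \<open>auto simp: al'_def nth_append\<close>)
    finally show ?thesis .
  qed
  then show lam: "lam = lam'" using l l' by (intro sorted_wrt_ge_mset_eq) auto
  have "mset al = mset al'"
  proof -
    have "al = map (\<lambda>i. al' ! \<pi> i) [0..<n]"
      by (rule nth_equalityI) (use al al_\<pi> in auto)
    then have "mset al = mset (map ((!) al') [0..<n])"
      using mset_map_upt_permutes[OF \<pi>, of "(!) al'"] by simp
    also have "map ((!) al') [0..<n] = al'" using al' by (metis map_nth)
    finally show ?thesis .
  qed
  then have "mset mu = mset mu'" using lam by (simp add: al_def al'_def)
  moreover have "sorted_wrt (\<ge>) mu" "sorted_wrt (\<ge>) mu'"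
    using l(4) l'(4) by (auto elim!: sorted_wrt_mono_rel[rotated])
  ultimately show mu: "mu = mu'" by (intro sorted_wrt_ge_mset_eq) auto
  \<comment> \<open>\<open>\<pi>\<close> keeps the letters from \<open>b\<close> on among themselves
    and preserves their parts of \<open>mu\<close>, which are distinct.\<close>
  have outside: "\<pi> i = i" if i: "i \<in> {..<n} - {..<b}" for i
  proof -
    have "\<pi> i < n" using permutes_in_image[OF \<pi>, of i] i by simp
    moreover have "\<pi> i \<notin> {..<b}"
    proof
      assume "\<pi> i \<in> {..<b}"
      then have "\<pi> i \<in> \<pi> ` {..<b}" by (simp only: image_b)
      then have "i \<in> {..<b}" by (simp only: inj_image_mem_iff[OF permutes_inj[OF \<pi>]])
      then show False using i by simp
    qed
    ultimately have \<pi>i: "\<pi> i - b < n - b" "i - b < n - b" "b \<le> \<pi> i" "b \<le> i" using i by auto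
    have "mu ! (i - b) = mu ! (\<pi> i - b)"
      using al_\<pi>[of i] i \<pi>i l lam mu by (auto simp: al_def al'_def nth_append)
    moreover have "distinct mu" using l(4) by (metis distinct_rev sorted_wrt_rev strict_sorted_iff)
    ultimately have "i - b = \<pi> i - b" using \<pi>i l(2) by (metis nth_eq_iff_index_eq)
    then show ?thesis using \<pi>i by simp
  qed
  have \<pi>pb: "\<pi> permutes {..<b}" by (rule permutes_superset[OF \<pi> outside])
  have "q = map_permutation {..<b} ((+) c) \<pi>"
  proof
    have bij: "bij_betw ((+) c) {..<b} {c..<c + b}"
      by (rule bij_betw_byWitness[where f' = "\<lambda>i. i - c"]) auto
    fix j
    show "q j = map_permutation {..<b} ((+) c) \<pi> j"
    proof (cases "j \<in> {c..<c + b}")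
      case True
      then have j: "j = c + (j - c)" "j - c < b" by auto
      have "map_permutation {..<b} ((+) c) \<pi> (c + (j - c)) = c + \<pi> (j - c)"
        by (rule map_permutation_apply) (use j in auto)
      moreover have "q j \<in> {c..<c + b}" using permutes_in_image[OF q] True by simp
      ultimately show ?thesis using \<pi>_q[OF j(2)] j(1) by auto
    next
      case False
      then show ?thesis
        using permutes_not_in[OF q] permutes_not_in[OF map_permutation_permutes[OF bij \<pi>pb]] by simp
    qed
  qed
  then show "sign \<pi> = sign q"
    using sign_map_permutation[OF _ \<pi>pb, of "(+) c"] by simp
qed

text \<open>Up to a scalar, the projection of the basis tensor at the word \<open>u\<close> to
  \<open>sgn_sym_alt n k c\<close>; at the representatives these tensors are dual to
  evaluation.\<close>

definition pair_fun :: "nat \<Rightarrow> nat \<Rightarrow> nat \<Rightarrow> nat list \<Rightarrow> nat list \<Rightarrow> complex" where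
  "pair_fun n k c u = letter_avg n (avg False {..<c} (avg True {c..<k} (\<lambda>w. if w = u then 1 else 0)))"

lemma pair_fun_eq:
  "pair_fun n k c u w = (\<Sum>\<pi> | \<pi> permutes {..<n}. \<Sum>p | p permutes {..<c}. \<Sum>q | q permutes {c..<k}.
     of_int (sign \<pi>) * of_int (sign q) *
     (if permute_list q (permute_list p (map (inv \<pi>) w)) = u then 1 else 0))"
  by (simp add: pair_fun_def letter_avg_def avg_def perm_mat_act_def pos_act_permute_list
      sum_distrib_left chr_def mult.assoc)

lemma pair_fun_sgn_sym_alt:
  assumes "length u = k" "set u \<subseteq> {..<n}" "c \<le> k"
  shows "pair_fun n k c u \<in> sgn_sym_alt n k c"
  unfolding pair_fun_def
proof (rule letter_avg_sgn_sym_alt[OF _ assms(3)])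
  let ?g = "avg True {c..<k} (\<lambda>w. if w = u then 1 else 0)"
  have u: "(\<lambda>w. if w = u then 1 else 0) \<in> tensors n k" using assms by (auto simp: tensors_def)
  have g: "?g \<in> tensors n k" "skew True {c..<k} ?g"
    using u by (auto intro!: tensors_avg skew_avg)
  show "avg False {..<c} ?g \<in> sym_alt n k c"
    unfolding sym_alt_def mem_Collect_eq using assms(3)
    by (intro conjI tensors_avg[OF g(1)] skew_avg[OF g(1)] skew_avg_disjoint[OF g]) auto
qed

lemma pair_fun_self:
  assumes "(lam, mu) \<in> pairs n b c" "b \<le> n"
  shows "pair_fun n (c + b) c (pair_word (lam, mu)) (pair_word (lam, mu)) \<noteq> 0"
proof -
  let ?u = "pair_word (lam, mu)"
  \<comment> \<open>As \<open>sign \<pi> = sign q\<close>, every nonzero term is 1. Counted in the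
    naturals, a zero sum would make the identity term zero.\<close>
  define t :: "(nat \<Rightarrow> nat) \<Rightarrow> (nat \<Rightarrow> nat) \<Rightarrow> (nat \<Rightarrow> nat) \<Rightarrow> nat" where
    "t \<pi> p q = (if permute_list q (permute_list p (map (inv \<pi>) ?u)) = ?u then 1 else 0)" for \<pi> p q
  have "of_int (sign \<pi>) * of_int (sign q) *
      (if permute_list q (permute_list p (map (inv \<pi>) ?u)) = ?u then 1 else 0) = (of_nat (t \<pi> p q) :: complex)"
    if "\<pi> permutes {..<n}" "p permutes {..<c}" "q permutes {c..<c + b}" for \<pi> p q
    using pair_word_orbit(3)[OF assms(1,1,2) that] by (cases q rule: sign_cases) (auto simp: t_def)
  then have "pair_fun n (c + b) c ?u ?u =
      of_nat (\<Sum>\<pi> | \<pi> permutes {..<n}. \<Sum>p | p permutes {..<c}. \<Sum>q | q permutes {c..<c + b}. t \<pi> p q)"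
    unfolding pair_fun_eq of_nat_sum by (intro sum.cong refl) auto
  moreover have "(\<Sum>\<pi> | \<pi> permutes {..<n}. \<Sum>p | p permutes {..<c}. \<Sum>q | q permutes {c..<c + b}. t \<pi> p q) \<noteq> 0"
  proof
    assume "(\<Sum>\<pi> | \<pi> permutes {..<n}. \<Sum>p | p permutes {..<c}. \<Sum>q | q permutes {c..<c + b}. t \<pi> p q) = 0"
    then have "t id id id = 0" by (simp add: finite_permutations permutes_id)
    then show False by (simp add: t_def)
  qed
  ultimately show ?thesis by (simp only: of_nat_eq_0_iff not_False_eq_True)
qed

lemma pair_fun_other:
  assumes "x \<in> pairs n b c" "y \<in> pairs n b c" "x \<noteq> y" "b \<le> n"
  shows "pair_fun n (c + b) c (pair_word x) (pair_word y) = 0"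
proof -
  obtain lam mu lam' mu' where xy: "x = (lam, mu)" "y = (lam', mu')" by (cases x; cases y)
  have "permute_list q (permute_list p (map (inv \<pi>) (pair_word y))) \<noteq> pair_word x"
    if "\<pi> permutes {..<n}" "p permutes {..<c}" "q permutes {c..<c + b}" for \<pi> p q
    using pair_word_orbit(1,2)[OF assms(1,2)[unfolded xy] assms(4) that] assms(3) xy by auto
  then show ?thesis unfolding pair_fun_eq by (intro sum.neutral ballI) auto
qed

lemma dim_sgn_sym_alt:
  assumes bn: "b \<le> n"
  shows "\<exists>T. finite T \<and> sgn_sym_alt n (c + b) c \<subseteq> fs.span T"
    "fs.dim (sgn_sym_alt n (c + b) c) = card (pairs n b c)"
proof -
  let ?S = "sgn_sym_alt n (c + b) c" and ?I = "pair_word ` pairs n b c"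
  let ?e = "pair_fun n (c + b) c"
  have fin: "finite ?I" using finite_pairs by blast
  \<comment> \<open>If two distinct pairs had the same word, its \<open>pair_fun\<close> would be
    both zero and nonzero there.\<close>
  have inj: "inj_on pair_word (pairs n b c)"
    by (intro inj_onI) (metis bn pair_fun_other pair_fun_self surj_pair)
  have 1: "f = 0" if "f \<in> ?S" "\<And>x. x \<in> ?I \<Longrightarrow> f x = 0" for f
    by (rule sgn_sym_alt_eq_0[OF that(1)]) (use that(2) in auto)
  have 2: "?e x \<in> ?S" if xI: "x \<in> ?I" for x
  proof -
    obtain lam mu where x: "x = letters (lam @ mu) @ [0..<b]" "(lam, mu) \<in> pairs n b c"
      using xI by (force simp: pair_word_def pairs_def)
    show ?thesis
      by (rule pair_fun_sgn_sym_alt) (use x bn set_letters[of "lam @ mu"] in \<open>auto simp: pairs_def length_letters\<close>)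
  qed
  have 3: "?e x x \<noteq> 0" if "x \<in> ?I" for x using that bn pair_fun_self by auto
  have 4: "?e x y = 0" if "x \<in> ?I" "y \<in> ?I" "x \<noteq> y" for x y using that bn pair_fun_other by blast
  note basis = evaluation_basis[OF subspace_sgn_sym_alt fin 1 2 3 4]
  show "\<exists>T. finite T \<and> ?S \<subseteq> fs.span T" using basis(1) fin by blast
  show "fs.dim ?S = card (pairs n b c)" using basis(2) by (simp add: card_image[OF inj])
qed

lemma linear_ext_sum: "Vector_Spaces.linear cscale cscale (ext_sum e B m)"
  by unfold_locales
    (auto simp: ext_sum_def pos_act_def fun_eq_iff algebra_simps sum.distrib sum_distrib_left)

section \<open>The multiplicity\<close>

definition sgn_cycles :: "nat \<Rightarrow> nat \<Rightarrow> nat \<Rightarrow> (nat list \<Rightarrow> complex) set" where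
  "sgn_cycles n k c = {f \<in> cycles n k c. sgn_equivariant n f}"

text \<open>The differential trades a unit of \<open>b\<close> for one of \<open>c\<close> with
  \<open>c + b\<close> fixed, so the induction on \<open>b\<close> leaves \<open>c\<close> free.
  Rank-nullity and exactness give the recursion that \<open>card_pairs\<close> gives for top
  pairs.\<close>

lemma dim_sgn_cycles:
  assumes "b < n"
  shows "fs.dim (sgn_cycles n (c + b) c) = card (top_pairs n b c)"
  using assms
proof (induction b arbitrary: c)
  case 0
  \<comment> \<open>For \<open>b = 0\<close> both the cycle condition and the top condition are
    vacuous.\<close>
  have "sgn_cycles n (c + 0) c = sgn_sym_alt n (c + 0) c"
    by (auto simp: sgn_cycles_def sgn_sym_alt_def cycles_def)
  moreover have "top_pairs n 0 c = pairs n 0 c" by (auto simp: top_pairs_def)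
  ultimately show ?case using dim_sgn_sym_alt(2)[of 0 n c] by simp
next
  case (Suc b)
  let ?S = "sgn_sym_alt n (c + Suc b) c"
  obtain T where T: "finite T" "?S \<subseteq> fs.span T" using dim_sgn_sym_alt(1)[of "Suc b" n c] Suc.prems by auto
  have "{x \<in> ?S. koszul_d c x = 0} = sgn_cycles n (c + Suc b) c"
    by (auto simp: sgn_cycles_def sgn_sym_alt_def cycles_def zero_fun_def)
  moreover have "koszul_d c ` ?S = sgn_cycles n (Suc c + b) (Suc c)"
    using koszul_d_image[of c "c + Suc b" n] by (simp add: sgn_sym_alt_def sgn_cycles_def)
  ultimately have "card (pairs n (Suc b) c) =
      fs.dim (sgn_cycles n (c + Suc b) c) + fs.dim (sgn_cycles n (Suc c + b) (Suc c))"
    using rank_nullity[OF linear_ext_sum subspace_sgn_sym_alt T, of False "{..<Suc c}" c]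
      dim_sgn_sym_alt(2)[of "Suc b" n c] Suc.prems by simp
  also have "fs.dim (sgn_cycles n (Suc c + b) (Suc c)) = card (top_pairs n b (Suc c))"
    using Suc.prems by (intro Suc.IH) auto
  finally show ?case using card_pairs[of b n c] Suc.prems by simp
qed

theorem theoremB:
  fixes a b n :: nat
  assumes "b + 1 \<le> n"
  shows "sign_multiplicity n (hook a b) =
    card {(lam, mu). length lam = b \<and> sorted_wrt (\<ge>) lam \<and>
                     length mu = n - b \<and> sorted_wrt (>) mu \<and>
                     sum_list lam + sum_list mu = a + 1 \<and>
                     (b = 0 \<or> mu ! 0 > lam ! 0)}"
proof -
  have "sign_multiplicity n (hook a b) = fs.dim (sgn_cycles n (Suc a + b) (Suc a))"
    by (simp add: sign_multiplicity_def weyl_module_hook sgn_cycles_def sgn_equivariant_def)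
  also have "\<dots> = card (top_pairs n b (Suc a))"
    using assms by (intro dim_sgn_cycles) auto
  also have "top_pairs n b (Suc a) = {(lam, mu). length lam = b \<and> sorted_wrt (\<ge>) lam \<and>
                     length mu = n - b \<and> sorted_wrt (>) mu \<and>
                     sum_list lam + sum_list mu = a + 1 \<and>
                     (b = 0 \<or> mu ! 0 > lam ! 0)}"
    by (auto simp: top_pairs_def pairs_def)
  finally show ?thesis .
qed

end
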